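(* (a) There is a constant $c$ such that for every $n$ and all binary strings $x,y$ of length at most $n$ there exists a program $t$ that computes a permutation (bijection) of the set of all binary strings, maps $x$ to $y$, and satisfies $\mathrm{C}(t)\le \mathrm{CT}(x|y)+\mathrm{CT}(y|x)+c\log n$ (for $n\ge 2$). (b) This bound cannot be improved significantly: there are constants $c_1,c_2$ such that for all natural numbers $k,n$ with $n>2k$ there exist binary strings $x,y$ of length $n$ with $\mathrm{C}(x)\le k+c_1\log n$ and $\mathrm{C}(y)\le k+c_1\log n$, such that every program computing a bijection of the set of binary strings that maps $x$ to $y$ has complexity at least $2k-c_2$.
   Context: $\mathrm{C}(x|y)$ denotes plain conditional Kolmogorov complexity (length of a shortest program mapping $y$ to $x$ for a fixed optimal programming language; equivalently up to $O(1)$, the minimal complexity of a program mapping $y$ to $x$), and $\mathrm{C}(x)$ the unconditional plain complexity. The total conditional complexity $\mathrm{CT}(x|y)$ is the minimal complexity $\mathrm{C}(p)$ of a program $p$ that terminates on every input and maps $y$ to $x$. The complexity of a program is its plain Kolmogorov complexity.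
   Formalization: The optimal programming language is also assumed to admit computable translation of programs from every other language (else total programs may not exist), and in (b) log n is read as log max(n,2), since for k=0, n=1 the bound would demand C(x)=0. *)

theory Defs
  imports Complex_Main "HOL-Library.Nat_Bijection" "HOL-Library.Extended_Real"
begin

text \<open>Kleene's \<mu>-operator for a partial function: all values before the first zero must be defined.\<close>

definition mu_search :: "(nat \<rightharpoonup> nat) \<rightharpoonup> nat" where
  "mu_search h =
     (if \<exists>m. h m = Some 0 \<and> (\<forall>j<m. h j \<noteq> None) then Some (LEAST m. h m = Some 0) else None)"

text \<open>The unary partial recursive functions.  Functions of several arguments are represented through
  the Cantor pairing \<^const>\<open>prod_encode\<close>; this gives the same class as Kleene's schemes on tuples.
  In \<open>prec\<close> the argument encodes (parameter, recursion argument).\<close>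

inductive partial_recursive :: "(nat \<rightharpoonup> nat) \<Rightarrow> bool" where
  zero: "partial_recursive (\<lambda>_. Some 0)"
| succ: "partial_recursive (\<lambda>n. Some (Suc n))"
| left: "partial_recursive (\<lambda>n. Some (fst (prod_decode n)))"
| right: "partial_recursive (\<lambda>n. Some (snd (prod_decode n)))"
| pair: "partial_recursive f \<Longrightarrow> partial_recursive g \<Longrightarrow>
    partial_recursive (\<lambda>n. Option.bind (f n) (\<lambda>a. Option.bind (g n) (\<lambda>b. Some (prod_encode (a, b)))))"
| comp: "partial_recursive f \<Longrightarrow> partial_recursive g \<Longrightarrow>
    partial_recursive (\<lambda>n. Option.bind (g n) f)"
| prec: "partial_recursive f \<Longrightarrow> partial_recursive g \<Longrightarrow>
    partial_recursive (\<lambda>n. case prod_decode n of (a, k) \<Rightarrow>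
      rec_nat (f a) (\<lambda>m r. Option.bind r (\<lambda>v. g (prod_encode (a, prod_encode (m, v))))) k)"
| mu: "partial_recursive f \<Longrightarrow>
    partial_recursive (\<lambda>n. mu_search (\<lambda>m. f (prod_encode (n, m))))"

text \<open>Binary strings are numbered by bijective base-2 numeration, least significant digit first.\<close>

fun str_code :: "bool list \<Rightarrow> nat" where
  "str_code [] = 0"
| "str_code (b # bs) = 2 * str_code bs + (if b then 2 else 1)"

lemma bij_str_code: "bij str_code"
proof (rule bijI)
  show "inj str_code"
  proof (rule injI)
    fix p q show "str_code p = str_code q \<Longrightarrow> p = q"
    proof (induction p arbitrary: q)
      case Nil
      then show ?case by (cases q) (auto split: if_splits)
    next
      case (Cons b p)
      then obtain d r where q: "q = d # r" by (cases q) (auto split: if_splits)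
      from Cons.prems q have e: "2 * str_code p + (if b then 2 else 1) = 2 * str_code r + (if d then 2 else 1)"
        by simp
      have "b = d" using e by (cases b; cases d; simp; presburger)
      with e Cons.IH q show ?case by simp
    qed
  qed
  have "\<exists>p. str_code p = n" for n
  proof (induction n rule: less_induct)
    case (less n)
    show ?case
    proof (cases "n = 0")
      case True
      then show ?thesis by (intro exI[of _ "[]"]) simp
    next
      case False
      then have "(n - 1) div 2 < n" by presburger
      then obtain p where p: "str_code p = (n - 1) div 2" using less by blast
      have "n = 2 * ((n - 1) div 2) + (if even n then 2 else 1)"
        using False by (cases "even n"; simp; presburger)
      then have "str_code (even n # p) = n" using p by simp
      then show ?thesis by blast
    qed
  qed
  then show "surj str_code" by (metis surjI)
qed

definition computable :: "(bool list \<Rightarrow> bool list) \<Rightarrow> bool" where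
  "computable h \<longleftrightarrow> (\<exists>f. partial_recursive f \<and> (\<forall>p. f (str_code p) = Some (str_code (h p))))"

text \<open>\<open>U p y\<close> is the output, if any, of program \<open>p\<close> on input \<open>y\<close>.\<close>

type_synonym language = "bool list \<Rightarrow> bool list \<Rightarrow> bool list option"

definition programming_language :: "language \<Rightarrow> bool" where
  "programming_language U \<longleftrightarrow> (\<exists>f. partial_recursive f \<and>
     (\<forall>p y. f (prod_encode (str_code p, str_code y)) = map_option str_code (U p y)))"

definition cond_complexity :: "language \<Rightarrow> bool list \<Rightarrow> bool list \<Rightarrow> enat" where
  "cond_complexity U x y = (INF p \<in> {p. U p y = Some x}. enat (length p))"

definition complexity :: "language \<Rightarrow> bool list \<Rightarrow> enat" where
  "complexity U x = cond_complexity U x []"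

definition optimal_language :: "language \<Rightarrow> bool" where
  "optimal_language U \<longleftrightarrow> programming_language U \<and>
     (\<forall>V. programming_language V \<longrightarrow>
       (\<exists>c::nat. \<forall>x y. cond_complexity U x y \<le> cond_complexity V x y + enat c))"

text \<open>Optimality alone only concerns the lengths of programs for single input-output pairs: there are optimal
  languages in which no program is total.  Notions that refer to the behaviour of a program on all
  inputs need programs of any other language to be effectively translatable (Goedel property).\<close>

definition goedel_language :: "language \<Rightarrow> bool" where
  "goedel_language U \<longleftrightarrow> programming_language U \<and>
     (\<forall>V. programming_language V \<longrightarrow> (\<exists>h. computable h \<and> (\<forall>p y. U (h p) y = V p y)))"

definition total_program :: "language \<Rightarrow> bool list \<Rightarrow> bool" where
  "total_program U p \<longleftrightarrow> (\<forall>z. U p z \<noteq> None)"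

definition total_cond_complexity :: "language \<Rightarrow> bool list \<Rightarrow> bool list \<Rightarrow> enat" where
  "total_cond_complexity U x y = (INF p \<in> {p. total_program U p \<and> U p y = Some x}. complexity U p)"

definition computes_permutation :: "language \<Rightarrow> bool list \<Rightarrow> bool" where
  "computes_permutation U t \<longleftrightarrow> (\<exists>f. bij f \<and> (\<forall>z. U t z = Some (f z)))"

end

theory Submission imports Defs begin

text \<open>
  (a) Let \<open>q\<close> and \<open>p\<close> be total programs taking \<open>x\<close> to \<open>y\<close> and \<open>y\<close> to \<open>x\<close>. The pairs \<open>(u, q u)\<close> with
  \<open>p (q u) = u\<close> form a decidable matching that contains \<open>(x, y)\<close>. Restricted to the strings of length
  at most \<open>n\<close> it splits into finite chains and cycles, and closing up every chain extends it to a
  permutation, which is computable from descriptions of \<open>p\<close> and \<open>q\<close> and from \<open>n\<close>.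

  (b) Let \<open>Y\<close> be the set of the first \<open>2 ^ k\<close> strings of length \<open>n\<close>. Enumerate the programs of complexity
  below \<open>2 k\<close> that are defined on all strings of length \<open>n\<close> and take at most \<open>2 ^ k\<close> of them into \<open>Y\<close>;
  there are fewer than \<open>4 ^ k\<close>. Given about \<open>k\<close> bits, namely the number of these programs up to an error
  of \<open>2 ^ k / 2\<close>, one can find all but fewer than \<open>2 ^ k / 2\<close> of them. By averaging over the more than \<open>4 ^ k\<close>
  strings of length \<open>n\<close>, some \<open>x\<close> is taken into \<open>Y\<close> by at most \<open>2 ^ k / 2\<close> of the programs found, hence
  by fewer than \<open>2 ^ k\<close> programs altogether, and some \<open>y\<close> in \<open>Y\<close> is missed.
\<close>

section \<open>Total recursive functions and decidable predicates\<close>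

abbreviation pfst :: "nat \<Rightarrow> nat" where "pfst n \<equiv> fst (prod_decode n)"
abbreviation psnd :: "nat \<Rightarrow> nat" where "psnd n \<equiv> snd (prod_decode n)"

definition total_rec :: "(nat \<Rightarrow> nat) \<Rightarrow> bool" where
  "total_rec f \<longleftrightarrow> partial_recursive (\<lambda>n. Some (f n))"

lemma partial_rec_total: "total_rec f \<Longrightarrow> partial_recursive (\<lambda>n. Some (f n))"
  by (simp add: total_rec_def)

lemma total_rec_pfst_id: "total_rec (\<lambda>n. pfst n)"
  and total_rec_psnd_id: "total_rec (\<lambda>n. psnd n)"
  by (auto simp: total_rec_def intro: partial_recursive.left partial_recursive.right)

lemma total_rec_pair: "total_rec f \<Longrightarrow> total_rec g \<Longrightarrow> total_rec (\<lambda>n. prod_encode (f n, g n))"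
  using partial_recursive.pair[of "\<lambda>n. Some (f n)" "\<lambda>n. Some (g n)"] by (simp add: total_rec_def)

lemma partial_rec_comp_total:
  "partial_recursive f \<Longrightarrow> total_rec a \<Longrightarrow> partial_recursive (\<lambda>n. f (a n))"
  using partial_recursive.comp[of f "\<lambda>n. Some (a n)"] by (simp add: total_rec_def)

lemma total_rec_comp: "total_rec f \<Longrightarrow> total_rec a \<Longrightarrow> total_rec (\<lambda>n. f (a n))"
  using partial_rec_comp_total[of "\<lambda>n. Some (f n)" a] by (simp add: total_rec_def)

lemma total_rec_id: "total_rec (\<lambda>n. n)"
  using total_rec_pair[OF total_rec_pfst_id total_rec_psnd_id] by simp

lemma total_rec_const: "total_rec (\<lambda>n. c)"
proof (induction c)
  case 0
  show ?case by (simp add: total_rec_def partial_recursive.zero)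
next
  case (Suc c)
  show ?case
    using total_rec_comp[OF _ Suc, of Suc] by (simp add: total_rec_def partial_recursive.succ)
qed

lemma total_rec_Suc: "total_rec a \<Longrightarrow> total_rec (\<lambda>n. Suc (a n))"
  by (rule total_rec_comp[of Suc]) (auto simp: total_rec_def partial_recursive.succ)

lemmas total_rec_pfst = total_rec_comp[OF total_rec_pfst_id]
lemmas total_rec_psnd = total_rec_comp[OF total_rec_psnd_id]

lemmas total_rec_basic = total_rec_id total_rec_const total_rec_Suc total_rec_pfst total_rec_psnd
  total_rec_pair

text \<open>The continuation may depend on the input as well as on the intermediate value, so it has
  to be recursive on their pair. Stated with \<open>pfst e\<close> and \<open>psnd e\<close>, such
  closure rules can be chained by \<open>intro\<close>.\<close>

lemma partial_rec_bind:
  assumes "partial_recursive f" "partial_recursive (\<lambda>e. g (pfst e) (psnd e))"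
  shows "partial_recursive (\<lambda>n. Option.bind (f n) (\<lambda>v. g n v))"
proof -
  have "partial_recursive (\<lambda>n. Option.bind (f n) (\<lambda>a. Some (prod_encode (n, a))))"
    using partial_recursive.pair[OF partial_rec_total[OF total_rec_id] assms(1)] by simp
  from partial_recursive.comp[OF assms(2) this] show ?thesis
    by (simp add: Option.bind_assoc)
qed

lemma partial_rec_rec_nat:
  assumes "partial_recursive a"
    and "partial_recursive (\<lambda>e. g (pfst e) (pfst (psnd e)) (psnd (psnd e)))"
    and "total_rec b"
  shows "partial_recursive (\<lambda>n. rec_nat (a n) (\<lambda>m r. Option.bind r (\<lambda>v. g n m v)) (b n))"
  using partial_rec_comp_total[OF partial_recursive.prec[OF assms(1,2)]
      total_rec_pair[OF total_rec_id assms(3)]]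
  by simp

lemma total_rec_rec_nat:
  assumes "total_rec a"
    and "total_rec (\<lambda>e. g (pfst e) (pfst (psnd e)) (psnd (psnd e)))"
    and "total_rec b"
  shows "total_rec (\<lambda>n. rec_nat (a n) (\<lambda>m r. g n m r) (b n))"
proof -
  have "rec_nat (Some x) (\<lambda>m r. Option.bind r (\<lambda>v. Some (g n m v))) k = Some (rec_nat x (g n) k)"
    for x n k by (induction k) auto
  with partial_rec_rec_nat[OF partial_rec_total partial_rec_total, OF assms]
  show ?thesis by (simp add: total_rec_def)
qed

section \<open>Arithmetic\<close>

lemma total_rec_add:
  assumes "total_rec a" "total_rec b" shows "total_rec (\<lambda>n. a n + b n)"
proof -
  have "rec_nat x (\<lambda>_ r. Suc r) k = x + k" for x k by (induction k) auto
  moreover have "total_rec (\<lambda>n. rec_nat (a n) (\<lambda>m r. Suc r) (b n))"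
    by (intro total_rec_rec_nat total_rec_basic assms)
  ultimately show ?thesis by simp
qed

lemma total_rec_mult:
  assumes "total_rec a" "total_rec b" shows "total_rec (\<lambda>n. a n * b n)"
proof -
  have "rec_nat 0 (\<lambda>_ r. r + x) k = x * k" for x k :: nat by (induction k) auto
  moreover have "total_rec (\<lambda>n. rec_nat 0 (\<lambda>m r. r + a n) (b n))"
    by (intro total_rec_rec_nat total_rec_basic total_rec_add total_rec_comp[OF assms(1)] assms)
  ultimately show ?thesis by simp
qed

lemma total_rec_power:
  assumes "total_rec a" "total_rec b" shows "total_rec (\<lambda>n. a n ^ b n)"
proof -
  have "rec_nat 1 (\<lambda>_ r. r * x) k = x ^ k" for x k :: nat by (induction k) auto
  moreover have "total_rec (\<lambda>n. rec_nat 1 (\<lambda>m r. r * a n) (b n))"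
    by (intro total_rec_rec_nat total_rec_basic total_rec_mult total_rec_comp[OF assms(1)] assms)
  ultimately show ?thesis by simp
qed

lemma total_rec_diff:
  assumes "total_rec a" "total_rec b" shows "total_rec (\<lambda>n. a n - b n)"
proof -
  have pred: "total_rec (\<lambda>n. n - 1)"
  proof -
    have "rec_nat 0 (\<lambda>m r. m) k = k - 1" for k :: nat by (cases k) auto
    moreover have "total_rec (\<lambda>n. rec_nat 0 (\<lambda>m r. m) n)"
      by (intro total_rec_rec_nat total_rec_basic)
    ultimately show ?thesis by simp
  qed
  have "rec_nat x (\<lambda>_ r. r - 1) k = x - k" for x k :: nat by (induction k) auto
  moreover have "total_rec (\<lambda>n. rec_nat (a n) (\<lambda>m r. r - 1) (b n))"
    by (intro total_rec_rec_nat total_rec_comp[OF pred] total_rec_basic assms)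
  ultimately show ?thesis by simp
qed

lemma total_rec_sum:
  assumes "total_rec (\<lambda>e. g (pfst e) (psnd e))" "total_rec b"
  shows "total_rec (\<lambda>n. \<Sum>i<b n. g n i)"
proof -
  have "rec_nat 0 (\<lambda>m r. r + g n m) k = (\<Sum>i<k. g n i)" for n k by (induction k) auto
  moreover have "total_rec (\<lambda>n. rec_nat 0 (\<lambda>m r. r + g n m) (b n))"
    using total_rec_comp[OF assms(1), of "\<lambda>e. prod_encode (pfst e, pfst (psnd e))"]
    by (intro total_rec_rec_nat total_rec_add total_rec_basic assms(2)) (simp add: total_rec_basic)
  ultimately show ?thesis by simp
qed

section \<open>Decidable predicates and bounded quantifiers\<close>

definition decidable :: "(nat \<Rightarrow> bool) \<Rightarrow> bool" where
  "decidable P \<longleftrightarrow> total_rec (\<lambda>n. of_bool (P n))"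

text \<open>A recursion of length 0 or 1: no step leaves the else branch, a single step replaces it
  by the then branch.\<close>

lemma total_rec_if:
  assumes "decidable P" "total_rec a" "total_rec b"
  shows "total_rec (\<lambda>n. if P n then a n else b n)"
proof -
  have "rec_nat (b n) (\<lambda>_ _. a n) (of_bool (P n)) = (if P n then a n else b n)" for n by simp
  moreover have "total_rec (\<lambda>n. rec_nat (b n) (\<lambda>_ _. a n) (of_bool (P n)))"
    using assms(1) unfolding decidable_def
    by (intro total_rec_rec_nat total_rec_basic total_rec_comp[OF assms(2)] assms)
  ultimately show ?thesis by simp
qed

lemma total_rec_of_bool: "decidable P \<Longrightarrow> total_rec (\<lambda>n. of_bool (P n))"
  by (simp add: decidable_def)

lemma decidable_not:
  assumes "decidable P" shows "decidable (\<lambda>n. \<not> P n)"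
proof -
  have "1 - of_bool Q = (of_bool (\<not> Q) :: nat)" for Q by simp
  then show ?thesis
    using total_rec_diff[OF total_rec_const[of 1] total_rec_of_bool[OF assms]]
    by (simp only: decidable_def)
qed

lemma decidable_conj: "decidable P \<Longrightarrow> decidable Q \<Longrightarrow> decidable (\<lambda>n. P n \<and> Q n)"
  unfolding decidable_def by (drule (1) total_rec_mult) (simp add: of_bool_conj)

lemma decidable_le:
  assumes "total_rec a" "total_rec b" shows "decidable (\<lambda>n. a n \<le> b n)"
proof -
  have "1 - (x - y) = of_bool (x \<le> y)" for x y :: nat by auto
  then show ?thesis
    using total_rec_diff[OF total_rec_const[of 1] total_rec_diff[OF assms]]
    by (simp add: decidable_def)
qed

lemma decidable_less:
  "total_rec a \<Longrightarrow> total_rec b \<Longrightarrow> decidable (\<lambda>n. a n < b n)"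
  using decidable_not[OF decidable_le[of b a]] by (simp only: not_le)

lemma decidable_eq:
  "total_rec a \<Longrightarrow> total_rec b \<Longrightarrow> decidable (\<lambda>n. a n = b n)"
  using decidable_conj[OF decidable_le[of a b] decidable_le[of b a]] by (simp only: order_eq_iff[symmetric])

lemma decidable_all_less:
  assumes "decidable (\<lambda>e. P (pfst e) (psnd e))" "total_rec b"
  shows "decidable (\<lambda>n. \<forall>i<b n. P n i)"
proof -
  have "(\<Sum>i<b n. of_bool (\<not> P n i) :: nat) = 0 \<longleftrightarrow> (\<forall>i<b n. P n i)" for n
    by auto
  moreover have "decidable (\<lambda>n. (\<Sum>i<b n. of_bool (\<not> P n i) :: nat) = 0)"
    by (intro decidable_eq total_rec_sum total_rec_of_bool decidable_not total_rec_basic assms)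
  ultimately show ?thesis by simp
qed

lemmas rec_intros = total_rec_basic total_rec_add total_rec_mult total_rec_power total_rec_diff
  total_rec_sum total_rec_if total_rec_of_bool
  decidable_not decidable_conj decidable_less decidable_le decidable_eq decidable_all_less

section \<open>Unbounded search and division\<close>

definition least_opt :: "(nat \<Rightarrow> bool) \<Rightarrow> nat option" where
  "least_opt P = (if \<exists>m. P m then Some (LEAST m. P m) else None)"

text \<open>The characteristic function of the negation is 0 exactly at a solution and is defined
  everywhere, so the condition of \<open>mu_search\<close> on earlier values holds
  automatically.\<close>

lemma partial_rec_least_opt:
  assumes "decidable (\<lambda>e. P (pfst e) (psnd e))"
  shows "partial_recursive (\<lambda>n. least_opt (\<lambda>m. P n m))"
proof -
  have eq: "Some (of_bool (\<not> Q)) = Some (0::nat) \<longleftrightarrow> Q" for Q by simp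
  have "total_rec (\<lambda>e. of_bool (\<not> P (pfst e) (psnd e)))"
    by (intro rec_intros assms)
  from partial_recursive.mu[OF partial_rec_total[OF this]] show ?thesis
    by (simp only: mu_search_def least_opt_def eq prod_encode_inverse fst_conv snd_conv) simp
qed

lemma total_rec_Least:
  assumes "decidable (\<lambda>e. P (pfst e) (psnd e))" "\<And>n. \<exists>m. P n m"
  shows "total_rec (\<lambda>n. LEAST m. P n m)"
  using partial_rec_least_opt[of P] assms by (simp add: total_rec_def least_opt_def)

lemma total_rec_div:
  assumes "total_rec a" "total_rec b" shows "total_rec (\<lambda>n. a n div b n)"
proof -
  \<comment> \<open>The quotient is the least \<open>m\<close> with \<open>x < y * (m + 1)\<close>;
    for \<open>y = 0\<close> the search stops at 0, in agreement with
    \<open>x div 0 = 0\<close>.\<close>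
  have eq: "(LEAST m. \<not> (y * (m + 1) \<le> x \<and> y \<noteq> 0)) = x div y" for x y :: nat
  proof (cases "y = 0")
    case False
    show ?thesis
    proof (rule Least_equality)
      show "\<not> (y * (x div y + 1) \<le> x \<and> y \<noteq> 0)"
        using False dividend_less_times_div[of y x] by simp
      fix m assume "\<not> (y * (m + 1) \<le> x \<and> y \<noteq> 0)"
      then have "x < (m + 1) * y" using False by (simp add: mult.commute)
      then show "x div y \<le> m" using less_mult_imp_div_less[of x "m + 1" y] by simp
    qed
  qed simp
  have "total_rec (\<lambda>n. LEAST m. \<not> (b n * (m + 1) \<le> a n \<and> b n \<noteq> 0))"
  proof (intro total_rec_Least rec_intros total_rec_comp[OF assms(1)] total_rec_comp[OF assms(2)])
    show "\<exists>m. \<not> (b n * (m + 1) \<le> a n \<and> b n \<noteq> 0)" for n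
      using dividend_less_times_div[of "b n" "a n"]
      by (cases "b n = 0") (auto intro!: exI[of _ "a n div b n"])
  qed
  then show ?thesis by (simp only: eq)
qed

lemma total_rec_mod:
  assumes "total_rec a" "total_rec b" shows "total_rec (\<lambda>n. a n mod b n)"
  using total_rec_diff[OF assms(1) total_rec_mult[OF assms(2) total_rec_div[OF assms]]]
  by (simp add: minus_mult_div_eq_mod)

section \<open>Stagewise approximation of partial recursive functions\<close>

text \<open>This form refers only to defined values of \<open>h\<close>, so it visibly survives
  extending \<open>h\<close>.\<close>

lemma mu_search_eq_Some_iff:
  "mu_search h = Some m \<longleftrightarrow> h m = Some 0 \<and> (\<forall>j<m. \<exists>v. h j = Some (Suc v))"
proof
  assume *: "mu_search h = Some m"
  then obtain l where l: "h l = Some 0" "\<forall>j<l. h j \<noteq> None" and m: "m = (LEAST m. h m = Some 0)"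
    by (auto simp: mu_search_def split: if_splits)
  have "h m = Some 0" "m \<le> l" using l m by (auto intro: LeastI Least_le)
  moreover have "h j \<noteq> Some 0" if "j < m" for j using that m not_less_Least by blast
  ultimately show "h m = Some 0 \<and> (\<forall>j<m. \<exists>v. h j = Some (Suc v))"
    using l(2) by (metis less_le_trans not0_implies_Suc option.exhaust)
next
  assume *: "h m = Some 0 \<and> (\<forall>j<m. \<exists>v. h j = Some (Suc v))"
  then have "(LEAST m. h m = Some 0) = m"
    by (intro Least_equality) (auto simp: not_less[symmetric])
  with * show "mu_search h = Some m" by (fastforce simp: mu_search_def)
qed

lemma mu_search_mono:
  assumes "\<And>m v. h m = Some v \<Longrightarrow> h' m = Some v" "mu_search h = Some m"
  shows "mu_search h' = Some m"
  using assms unfolding mu_search_eq_Some_iff by blast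

definition opt_code :: "nat option \<Rightarrow> nat" where "opt_code = case_option 0 Suc"

lemma opt_code_simps [simp]: "opt_code None = 0" "opt_code (Some v) = Suc v"
  by (simp_all add: opt_code_def)

lemma opt_code_bind:
  "opt_code (Option.bind x f) = (if opt_code x = 0 then 0 else opt_code (f (opt_code x - 1)))"
  by (cases x) auto

text \<open>\<open>g s n\<close> plays the role of running \<open>f\<close> on \<open>n\<close> for
  \<open>s\<close> steps: computable at each stage, increasing in \<open>s\<close>, with limit
  \<open>f\<close>.\<close>

definition stages :: "(nat \<Rightarrow> nat \<rightharpoonup> nat) \<Rightarrow> (nat \<rightharpoonup> nat) \<Rightarrow> bool" where
  "stages g f \<longleftrightarrow> total_rec (\<lambda>e. opt_code (g (psnd e) (pfst e))) \<and>
     (\<forall>s t n v. s \<le> t \<longrightarrow> g s n = Some v \<longrightarrow> g t n = Some v) \<and>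
     (\<forall>n v. f n = Some v \<longleftrightarrow> (\<exists>s. g s n = Some v))"

lemma stages_rec:
  assumes "stages g f" "total_rec a" "total_rec b"
  shows "total_rec (\<lambda>n. opt_code (g (a n) (b n)))"
  using total_rec_comp[of "\<lambda>e. opt_code (g (psnd e) (pfst e))", OF _ total_rec_pair[OF assms(3,2)]] assms(1)
  by (simp add: stages_def)

lemma stages_mono: "stages g f \<Longrightarrow> g s n = Some v \<Longrightarrow> s \<le> t \<Longrightarrow> g t n = Some v"
  and stages_sound: "stages g f \<Longrightarrow> g s n = Some v \<Longrightarrow> f n = Some v"
  and stages_complete: "stages g f \<Longrightarrow> f n = Some v \<Longrightarrow> \<exists>s. g s n = Some v"
  unfolding stages_def by blast+

lemma stages_eventually:
  assumes "stages g f" "f n = Some v" shows "\<forall>\<^sub>F s in sequentially. g s n = Some v"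
  unfolding eventually_sequentially using stages_complete[OF assms] stages_mono[OF assms(1)] by blast

text \<open>Convergence is required at all large stages, because finitely many such conditions can
  be met at a common stage.\<close>

lemma stagesI:
  assumes "total_rec (\<lambda>e. opt_code (g (psnd e) (pfst e)))"
    and "\<And>s t n v. s \<le> t \<Longrightarrow> g s n = Some v \<Longrightarrow> g t n = Some v"
    and "\<And>s n v. g s n = Some v \<Longrightarrow> f n = Some v"
    and "\<And>n v. f n = Some v \<Longrightarrow> \<forall>\<^sub>F s in sequentially. g s n = Some v"
  shows "stages g f"
  unfolding stages_def using assms(1,2,3) eventually_happens'[OF sequentially_bot assms(4)] by blast

lemma stages_total: "total_rec f \<Longrightarrow> stages (\<lambda>s n. Some (f n)) (\<lambda>n. Some (f n))"
  by (rule stagesI) (auto simp: opt_code_def intro!: total_rec_Suc total_rec_comp[of f] total_rec_pfst_id)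

lemma stages_pair:
  assumes F: "stages F f" and G: "stages G g"
  shows "stages
    (\<lambda>s n. Option.bind (F s n) (\<lambda>a. Option.bind (G s n) (\<lambda>b. Some (prod_encode (a, b)))))
    (\<lambda>n. Option.bind (f n) (\<lambda>a. Option.bind (g n) (\<lambda>b. Some (prod_encode (a, b)))))"
proof (rule stagesI, goal_cases)
  case 1
  show ?case unfolding opt_code_bind opt_code_simps
    by (intro rec_intros stages_rec[OF F] stages_rec[OF G])
next
  case (4 n v)
  then obtain a b where "f n = Some a" "g n = Some b" and v: "v = prod_encode (a, b)"
    by (auto simp: bind_eq_Some_conv)
  from stages_eventually[OF F this(1)] stages_eventually[OF G this(2)] show ?case
    by eventually_elim (simp add: v)
next
  case (2 s t n v)
  then show ?case
    by (auto simp: bind_eq_Some_conv dest: stages_mono[OF F _ 2(1)] stages_mono[OF G _ 2(1)])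
next
  case (3 s n v)
  then show ?case by (auto simp: bind_eq_Some_conv dest: stages_sound[OF F] stages_sound[OF G])
qed

lemma stages_comp:
  assumes F: "stages F f" and G: "stages G g"
  shows "stages (\<lambda>s n. Option.bind (G s n) (F s)) (\<lambda>n. Option.bind (g n) f)"
proof (rule stagesI, goal_cases)
  case 1
  show ?case unfolding opt_code_bind
    by (intro rec_intros stages_rec[OF F] stages_rec[OF G])
next
  case (4 n v)
  then obtain a where "g n = Some a" "f a = Some v"
    by (auto simp: bind_eq_Some_conv)
  from stages_eventually[OF G this(1)] stages_eventually[OF F this(2)] show ?case
    by eventually_elim simp
next
  case (2 s t n v)
  then show ?case
    by (auto simp: bind_eq_Some_conv dest: stages_mono[OF F _ 2(1)] stages_mono[OF G _ 2(1)])
next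
  case (3 s n v)
  then show ?case by (auto simp: bind_eq_Some_conv dest: stages_sound[OF F] stages_sound[OF G])
qed

text \<open>A terminating recursion makes finitely many calls, whose stages are combined by
  induction on \<open>k\<close>. At a fixed stage it becomes a primitive recursion on option
  codes.\<close>

lemma stages_prec:
  assumes F: "stages F f" and G: "stages G g"
  defines "R \<equiv> \<lambda>(\<phi>::nat \<rightharpoonup> nat) \<gamma> a k.
    rec_nat (\<phi> a) (\<lambda>m r. Option.bind r (\<lambda>v. \<gamma> (prod_encode (a, prod_encode (m, v))))) k"
  shows "stages (\<lambda>s n. case prod_decode n of (a, k) \<Rightarrow> R (F s) (G s) a k)
    (\<lambda>n. case prod_decode n of (a, k) \<Rightarrow> R f g a k)"
proof (rule stagesI, goal_cases)
  case 1
  have "opt_code (R (F s) (G s) a k) = rec_nat (opt_code (F s a))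
      (\<lambda>m r. if r = 0 then 0 else opt_code (G s (prod_encode (a, prod_encode (m, r - 1))))) k" for s a k
    by (induction k) (auto simp: R_def opt_code_bind)
  then show ?case unfolding case_prod_beta
    by (simp only:) (intro total_rec_rec_nat rec_intros stages_rec[OF F] stages_rec[OF G])
next
  case (2 s t n v)
  have "R (F s) (G s) a k = Some w \<Longrightarrow> R (F t) (G t) a k = Some w" for a k w
    by (induction k arbitrary: w)
       (auto simp: R_def bind_eq_Some_conv dest: stages_mono[OF F _ 2(1)] stages_mono[OF G _ 2(1)])
  with 2 show ?case by (auto split: prod.splits)
next
  case (3 s n v)
  have "R (F s) (G s) a k = Some w \<Longrightarrow> R f g a k = Some w" for a k w
    by (induction k arbitrary: w)
       (auto simp: R_def bind_eq_Some_conv dest: stages_sound[OF F] stages_sound[OF G])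
  with 3 show ?case by (auto split: prod.splits)
next
  case (4 n v)
  have "R f g a k = Some w \<Longrightarrow> \<forall>\<^sub>F s in sequentially. R (F s) (G s) a k = Some w" for a k w
  proof (induction k arbitrary: w)
    case 0
    then show ?case using stages_eventually[OF F] by (simp add: R_def)
  next
    case (Suc k)
    then obtain u where "R f g a k = Some u" and
      u: "g (prod_encode (a, prod_encode (k, u))) = Some w"
      by (auto simp: R_def bind_eq_Some_conv)
    from Suc.IH[OF this(1)] stages_eventually[OF G u] show ?case
      by eventually_elim (simp add: R_def)
  qed
  with 4 show ?case by (auto split: prod.splits)
qed

text \<open>Cutting the search off at \<open>s\<close> keeps each stage finite and loses nothing in
  the limit.\<close>

lemma stages_mu:
  assumes F: "stages F f"
  shows "stages (\<lambda>s n. mu_search (\<lambda>m. if m < s then F s (prod_encode (n, m)) else None))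
    (\<lambda>n. mu_search (\<lambda>m. f (prod_encode (n, m))))"
proof (rule stagesI, goal_cases)
  case 1
  \<comment> \<open>At most one \<open>m\<close> is the first zero, so the sum has at most one
    nonzero term \<open>Suc m\<close>, the option code of the result.\<close>
  have "opt_code (mu_search (\<lambda>m. if m < s then F s (prod_encode (n, m)) else None)) =
    (\<Sum>m<s. if opt_code (F s (prod_encode (n, m))) = 1 \<and>
      (\<forall>j<m. \<not> opt_code (F s (prod_encode (n, j))) \<le> 1) then Suc m else 0)" (is "?l = (\<Sum>m<s. if ?P m then _ else _)")
    for s n
  proof -
    have P: "mu_search (\<lambda>m. if m < s then F s (prod_encode (n, m)) else None) = Some m \<longleftrightarrow> m < s \<and> ?P m" for m
    proof -
      have Suc: "(\<exists>v. x = Some (Suc v)) \<longleftrightarrow> \<not> opt_code x \<le> 1" for x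
      proof (cases x)
        case (Some v)
        then show ?thesis by (cases v) auto
      qed simp
      have zero: "x = Some 0 \<longleftrightarrow> opt_code x = 1" for x by (cases x) auto
      show ?thesis unfolding mu_search_eq_Some_iff Suc zero
        by (cases "m < s") auto
    qed
    show ?thesis
    proof (cases "mu_search (\<lambda>m. if m < s then F s (prod_encode (n, m)) else None)")
      case None
      with P have "\<And>m. m < s \<Longrightarrow> \<not> ?P m" by simp
      with None show ?thesis by (intro trans[OF _ sum.neutral[symmetric]]) auto
    next
      case (Some m)
      then have m: "m < s" using P by blast
      have eq: "?P i \<longleftrightarrow> i = m" if "i < s" for i
        using P[of i] Some that by (metis option.inject)
      have "(\<Sum>i<s. if ?P i then Suc i else 0) = (\<Sum>i<s. if i = m then Suc i else 0)"
        by (intro sum.cong refl) (simp only: eq lessThan_iff)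
      then show ?thesis using m Some by simp
    qed
  qed
  then show ?case by (simp only:) (intro rec_intros stages_rec[OF F])
next
  case (2 s t n v)
  show ?case
    by (rule mu_search_mono[OF _ 2(2)]) (use 2(1) in \<open>auto split: if_splits intro: stages_mono[OF F]\<close>)
next
  case (3 s n v)
  show ?case
    by (rule mu_search_mono[OF _ 3]) (auto split: if_splits intro: stages_sound[OF F])
next
  case (4 n v)
  then have 0: "f (prod_encode (n, v)) = Some 0" and
    S: "\<And>j. j < v \<Longrightarrow> \<exists>w. f (prod_encode (n, j)) = Some (Suc w)"
    by (auto simp: mu_search_eq_Some_iff)
  have "\<forall>\<^sub>F s in sequentially. \<forall>j\<in>{..<v}. \<exists>w. F s (prod_encode (n, j)) = Some (Suc w)"
  proof (intro eventually_ball_finite ballI)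
    fix j assume "j \<in> {..<v}"
    with S obtain w where "f (prod_encode (n, j)) = Some (Suc w)" by auto
    from stages_eventually[OF F this]
    show "\<forall>\<^sub>F s in sequentially. \<exists>w. F s (prod_encode (n, j)) = Some (Suc w)"
      by eventually_elim blast
  qed simp
  with eventually_gt_at_top[of v] stages_eventually[OF F 0] show ?case
    by eventually_elim (simp add: mu_search_eq_Some_iff)
qed

text \<open>Lets the lower bound watch all programs in parallel and decide what has been output so
  far.\<close>

theorem partial_recursive_stages: "partial_recursive f \<Longrightarrow> \<exists>g. stages g f"
proof (induction rule: partial_recursive.induct)
  case zero
  show ?case by (rule exI, rule stages_total[OF total_rec_const])
next
  case succ
  show ?case by (rule exI, rule stages_total) (intro rec_intros)
next
  case left
  show ?case by (rule exI, rule stages_total[OF total_rec_pfst_id])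
next
  case right
  show ?case by (rule exI, rule stages_total[OF total_rec_psnd_id])
next
  case (pair f g)
  then show ?case using stages_pair by blast
next
  case (comp f g)
  then show ?case using stages_comp by blast
next
  case (prec f g)
  then show ?case using stages_prec by blast
next
  case (mu f)
  then show ?case using stages_mu by blast
qed

section \<open>Short descriptions\<close>

lemma str_code_bounds: "2 ^ length p \<le> Suc (str_code p)" "Suc (str_code p) < 2 ^ Suc (length p)"
  by (induction p) auto

text \<open>So the strings of length \<open>n\<close> have the codes \<open>2 ^ n - 1 + i\<close>
  with \<open>i < 2 ^ n\<close>, which is how the lower bound indexes them.\<close>

lemma length_eq_iff_str_code:
  "length p = n \<longleftrightarrow> 2 ^ n \<le> Suc (str_code p) \<and> Suc (str_code p) < 2 ^ Suc n"
proof
  assume *: "2 ^ n \<le> Suc (str_code p) \<and> Suc (str_code p) < 2 ^ Suc n"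
  have "(2::nat) ^ n < 2 ^ Suc (length p)" "(2::nat) ^ length p < 2 ^ Suc n"
    using * str_code_bounds[of p] by linarith+
  then have "n < Suc (length p)" "length p < Suc n"
    by (auto dest: power_less_imp_less_exp[rotated] simp del: power_Suc)
  then show "length p = n" by simp
qed (use str_code_bounds in blast)

abbreviation str_decode :: "nat \<Rightarrow> bool list" where "str_decode \<equiv> inv str_code"

lemma str_decode_code [simp]: "str_decode (str_code p) = p"
  and str_code_decode [simp]: "str_code (str_decode m) = m"
  using bij_str_code by (simp_all add: bij_is_inj bij_is_surj surj_f_inv_f)

section \<open>Complexity bounds from decompressors\<close>

lemma programming_language_of:
  assumes "partial_recursive F"
  shows "programming_language (\<lambda>p y. map_option str_decode (F (prod_encode (str_code p, str_code y))))"
  unfolding programming_language_def using assms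
  by (intro exI[of _ F]) (auto simp: option.map_comp o_def option.map_ident)

lemma INF_le_enat_iff: "(INF x\<in>A. f x) \<le> enat a \<longleftrightarrow> (\<exists>x\<in>A. f x \<le> enat a)"
proof -
  have "y \<le> enat a \<longleftrightarrow> y < enat (Suc a)" for y by (cases y) auto
  then show ?thesis by (simp add: INF_less_iff)
qed

lemma cond_complexity_le_iff:
  "cond_complexity U x y \<le> enat a \<longleftrightarrow> (\<exists>p. U p y = Some x \<and> length p \<le> a)"
  by (simp add: cond_complexity_def INF_le_enat_iff)

text \<open>Viewed as a language that ignores the condition, \<open>F\<close> is a decompressor, and
  \<open>U\<close> matches it up to a constant.\<close>

lemma optimal_complexity_le:
  assumes "optimal_language U" "partial_recursive F"
  shows "\<exists>c. \<forall>x p a. F (str_code p) = Some (str_code x) \<longrightarrow> length p \<le> a \<longrightarrow> complexity U x \<le> enat (a + c)"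
proof -
  let ?V = "\<lambda>p y. map_option str_decode (F (pfst (prod_encode (str_code p, str_code y))))"
  have "programming_language ?V"
    by (rule programming_language_of) (intro partial_rec_comp_total[OF assms(2)] rec_intros)
  then obtain c where c: "\<And>x y. cond_complexity U x y \<le> cond_complexity ?V x y + enat c"
    using assms(1) unfolding optimal_language_def by blast
  have "complexity U x \<le> enat (a + c)"
    if "F (str_code p) = Some (str_code x)" "length p \<le> a" for x p a
  proof -
    have "cond_complexity ?V x [] \<le> enat a"
      using that unfolding cond_complexity_le_iff by (intro exI[of _ p]) simp
    then have "cond_complexity ?V x [] + enat c \<le> enat (a + c)"
      by (metis add_right_mono plus_enat_simps(1))
    then show ?thesis using c[of x "[]"] by (auto simp: complexity_def)
  qed
  then show ?thesis by blast
qed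

text \<open>The exponent \<open>J\<close> is recovered as the multiplicity of 2 in the packed number.\<close>

definition pack :: "nat \<Rightarrow> nat \<Rightarrow> nat \<Rightarrow> nat \<Rightarrow> nat" where
  "pack J l n r = 2 ^ J * (2 * (l + 2 ^ J * (n + 2 ^ J * r)) + 1)"

lemma mixed_radix_less:
  fixes l r M B :: nat
  assumes "l < M" "r < B" shows "l + M * r < M * B"
proof -
  have "M * r + M \<le> M * B" using assms(2) by (metis Suc_leI add.commute mult_Suc_right mult_le_mono2)
  with assms(1) show ?thesis by simp
qed

text \<open>There are \<open>J\<close> trailing zero bits, one marker bit, \<open>J\<close> bits
  each for \<open>l\<close> and \<open>n\<close>, and \<open>b\<close> bits for
  \<open>r\<close>.\<close>

lemma pack_less:
  assumes "l < 2 ^ J" "n < 2 ^ J" "r < 2 ^ b"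
  shows "pack J l n r < 2 ^ Suc (b + 3 * J)"
proof -
  have "l + 2 ^ J * (n + 2 ^ J * r) < 2 ^ J * (2 ^ J * 2 ^ b)"
    by (intro mixed_radix_less assms)
  then have "2 * (l + 2 ^ J * (n + 2 ^ J * r)) + 1 < 2 * (2 ^ J * (2 ^ J * 2 ^ b))"
    by simp
  then have "pack J l n r < 2 ^ J * (2 * (2 ^ J * (2 ^ J * 2 ^ b)))"
    unfolding pack_def by (rule mult_strict_left_mono) simp
  also have "\<dots> = 2 ^ Suc (b + 3 * J)"
    by (simp add: power_add numeral_3_eq_3)
  finally show ?thesis .
qed

lemma unpack_total_rec:
  "\<exists>D. total_rec D \<and> (\<forall>J l n r. l < 2 ^ J \<longrightarrow> n < 2 ^ J \<longrightarrow>
     D (pack J l n r) = prod_encode (l, prod_encode (n, r)))"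
proof -
  \<comment> \<open>The cofactor of \<open>2 ^ J\<close> in a packed number is odd, so
    \<open>E\<close> returns exactly \<open>J\<close>. The clause \<open>m \<noteq> 0\<close> makes
    the search stop at 0.\<close>
  define E where "E m = (LEAST J. \<not> (m mod 2 ^ Suc J = 0 \<and> m \<noteq> 0))" for m :: nat
  define Q where "Q m = m div 2 ^ Suc (E m)" for m
  define D where "D m = prod_encode (Q m mod 2 ^ E m,
    prod_encode (Q m div 2 ^ E m mod 2 ^ E m, Q m div 2 ^ E m div 2 ^ E m))" for m
  have E_rec: "total_rec E" unfolding E_def
  proof (intro total_rec_Least rec_intros total_rec_mod)
    show "\<exists>J. \<not> (m mod 2 ^ Suc J = 0 \<and> m \<noteq> 0)" for m :: nat
    proof (intro exI[of _ m])
      have "m < 2 ^ Suc m" using less_exp[of "Suc m"] by linarith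
      then show "\<not> (m mod 2 ^ Suc m = 0 \<and> m \<noteq> 0)" by auto
    qed
  qed
  have Q_rec: "total_rec Q" unfolding Q_def
    by (intro total_rec_div rec_intros E_rec)
  have "total_rec D" unfolding D_def
    by (intro total_rec_div total_rec_mod rec_intros E_rec Q_rec)
  moreover have "D (pack J l n r) = prod_encode (l, prod_encode (n, r))"
    if l: "l < 2 ^ J" and n: "n < 2 ^ J" for J l n r
  proof -
    define q where "q = l + 2 ^ J * (n + 2 ^ J * r)"
    have pack: "pack J l n r = 2 ^ J * (2 * q + 1)" by (simp add: pack_def q_def)
    have "E (pack J l n r) = J" unfolding E_def
    proof (rule Least_equality)
      have "pack J l n r mod 2 ^ Suc J = 2 ^ J * ((2 * q + 1) mod 2)"
        unfolding pack power_Suc2 by (rule mult_mod_right[symmetric])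
      then show "\<not> (pack J l n r mod 2 ^ Suc J = 0 \<and> pack J l n r \<noteq> 0)" by simp
      fix i assume i: "\<not> (pack J l n r mod 2 ^ Suc i = 0 \<and> pack J l n r \<noteq> 0)"
      show "J \<le> i"
      proof (rule ccontr)
        assume "\<not> J \<le> i"
        then have "(2::nat) ^ Suc i dvd 2 ^ J" by (intro le_imp_power_dvd) simp
        then have "2 ^ Suc i dvd pack J l n r" unfolding pack by (rule dvd_mult2)
        moreover have "pack J l n r \<noteq> 0" by (simp add: pack)
        ultimately show False using i by (simp only: dvd_eq_mod_eq_0) simp
      qed
    qed
    moreover have "2 ^ J * (2 * q + 1) div 2 ^ Suc J = (2 * q + 1) div 2"
      unfolding power_Suc2 by (rule div_mult_mult1) simp
    ultimately have "E (pack J l n r) = J" "Q (pack J l n r) = q"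
      by (simp_all only: Q_def pack)
    moreover have "q mod 2 ^ J = l" "q div 2 ^ J = n + 2 ^ J * r" using l by (simp_all add: q_def)
    ultimately show ?thesis using n by (simp add: D_def)
  qed
  ultimately show ?thesis by blast
qed

text \<open>Two auxiliary numbers cost \<open>3 * J\<close> bits beyond the payload
  \<open>r\<close>; with \<open>J\<close> close to \<open>log 2 n\<close> this yields the
  logarithmic terms of both bounds.\<close>

lemma complexity_triple_le:
  assumes "optimal_language U" "partial_recursive g"
  shows "\<exists>c. \<forall>l n r b J x. g (prod_encode (l, prod_encode (n, r))) = Some (str_code x) \<longrightarrow>
    l < 2 ^ J \<longrightarrow> n < 2 ^ J \<longrightarrow> r < 2 ^ b \<longrightarrow> complexity U x \<le> enat (b + 3 * J + c)"
proof -
  obtain D where D: "total_rec D"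
    "\<And>J l n r. l < 2 ^ J \<Longrightarrow> n < 2 ^ J \<Longrightarrow> D (pack J l n r) = prod_encode (l, prod_encode (n, r))"
    using unpack_total_rec by blast
  obtain c where c: "\<And>x p a. g (D (str_code p)) = Some (str_code x) \<Longrightarrow> length p \<le> a \<Longrightarrow>
      complexity U x \<le> enat (a + c)"
    using optimal_complexity_le[OF assms(1) partial_rec_comp_total[OF assms(2) D(1)]] by blast
  have "complexity U x \<le> enat (b + 3 * J + (c + 1))"
    if "g (prod_encode (l, prod_encode (n, r))) = Some (str_code x)" "l < 2 ^ J" "n < 2 ^ J" "r < 2 ^ b"
    for l n r b J x
  proof -
    define p where "p = str_decode (pack J l n r)"
    have "2 ^ length p \<le> (2::nat) ^ Suc (b + 3 * J)"
      using str_code_bounds(1)[of p] pack_less[OF that(2-4)] by (simp add: p_def)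
    then have "length p \<le> Suc (b + 3 * J)" by (rule power_le_imp_le_exp[rotated]) simp
    moreover have "g (D (str_code p)) = Some (str_code x)"
      using that D(2) by (simp add: p_def)
    ultimately show ?thesis using c[of p x "Suc (b + 3 * J)"] by simp
  qed
  then show ?thesis by blast
qed

section \<open>Closing a matching to a permutation\<close>

text \<open>The pairs \<open>(u, q u)\<close> form a partial injection below \<open>N\<close> with
  inverse \<open>p\<close>, although \<open>q\<close> and \<open>p\<close> themselves are
  arbitrary.\<close>

definition matched :: "(nat \<Rightarrow> nat) \<Rightarrow> (nat \<Rightarrow> nat) \<Rightarrow> nat \<Rightarrow> nat \<Rightarrow> bool" where
  "matched q p N u \<longleftrightarrow> u < N \<and> q u < N \<and> p (q u) = u"

text \<open>With \<open>p\<close> and \<open>q\<close> exchanged, \<open>matched p q N v\<close>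
  says that \<open>v\<close> is the partner of the matched element \<open>p v\<close>. The walk
  stands still at the beginning of a chain.\<close>

definition step_back :: "(nat \<Rightarrow> nat) \<Rightarrow> (nat \<Rightarrow> nat) \<Rightarrow> nat \<Rightarrow> nat \<Rightarrow> nat" where
  "step_back q p N v = (if matched p q N v then p v else v)"

lemma step_back_simps [simp]:
  "matched p q N v \<Longrightarrow> step_back q p N v = p v"
  "\<not> matched p q N v \<Longrightarrow> step_back q p N v = v"
  by (simp_all add: step_back_def)

text \<open>\<open>N\<close> steps suffice to reach the beginning of any chain, and cycles consist
  of matched elements only.\<close>

definition close_matching :: "(nat \<Rightarrow> nat) \<Rightarrow> (nat \<Rightarrow> nat) \<Rightarrow> nat \<Rightarrow> nat \<Rightarrow> nat" where
  "close_matching q p N u = (if matched q p N u then q u else (step_back q p N ^^ N) u)"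

lemma matched_flip: "matched q p N u \<Longrightarrow> matched p q N (q u)"
  by (auto simp: matched_def)

lemma step_back_fixed:
  "\<not> matched p q N ((step_back q p N ^^ i) u) \<Longrightarrow> (step_back q p N ^^ (i + d)) u = (step_back q p N ^^ i) u"
  by (induction d) auto

text \<open>Otherwise the walk would meet \<open>N + 1\<close> distinct elements below
  \<open>N\<close>. Every later point of the walk is matched forward, hence differs from
  \<open>u\<close>, and \<open>q\<close> carries any other coincidence back to this case.\<close>

lemma step_back_end_unmatched:
  assumes u: "\<not> matched q p N u"
  shows "\<not> matched p q N ((step_back q p N ^^ N) u)"
proof
  let ?b = "\<lambda>i. (step_back q p N ^^ i) u"
  assume *: "matched p q N (?b N)"
  have m: "matched p q N (?b i)" if "i \<le> N" for i
    using step_back_fixed[of p q N i u "N - i"] * that by force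
  have fwd: "?b (Suc i) = p (?b i)" if "i \<le> N" for i
    using m[OF that] by simp
  have bwd: "q (?b (Suc i)) = ?b i" if "i \<le> N" for i
    using m[OF that] fwd[OF that] by (simp add: matched_def)
  have neq: "?b i \<noteq> ?b j" if "i < j" "j \<le> N" for i j
    using that
  proof (induction i arbitrary: j)
    case 0
    then obtain k where k: "j = Suc k" by (cases j) auto
    have "matched q p N (?b j)"
      using matched_flip[OF m[of k]] fwd[of k] 0 k by simp
    then show ?case using u by auto
  next
    case (Suc i)
    then obtain k where k: "j = Suc k" by (cases j) auto
    then have "?b i \<noteq> ?b k" using Suc.IH[of k] Suc.prems by simp
    then have "q (?b (Suc i)) \<noteq> q (?b j)"
      using bwd[of i] bwd[of k] Suc.prems unfolding k by linarith
    then show ?case by metis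
  qed
  have "inj_on ?b {..N}"
    by (rule linorder_inj_onI) (use neq in auto)
  moreover have "?b ` {..N} \<subseteq> {..<N}" using m by (auto simp: matched_def)
  ultimately have "card {..N} \<le> card {..<N}" by (intro card_inj_on_le) auto
  then show False by simp
qed

text \<open>Walking forward with \<open>q\<close> retraces the walk and stays inside the matching
  until it arrives at \<open>u\<close>.\<close>

lemma step_back_undo:
  "\<exists>a. (q ^^ a) ((step_back q p N ^^ n) u) = u \<and>
    (\<forall>i<a. matched q p N ((q ^^ i) ((step_back q p N ^^ n) u)))"
proof (induction n)
  case 0
  show ?case by (intro exI[of _ 0]) simp
next
  case (Suc n)
  let ?v = "(step_back q p N ^^ n) u"
  obtain a where a: "(q ^^ a) ?v = u" "\<And>i. i < a \<Longrightarrow> matched q p N ((q ^^ i) ?v)"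
    using Suc by blast
  show ?case
  proof (cases "matched p q N ?v")
    case True
    then have v: "(step_back q p N ^^ Suc n) u = p ?v" "q (p ?v) = ?v"
      by (auto simp: matched_def)
    have "matched q p N ((q ^^ i) (p ?v))" if "i < Suc a" for i
    proof (cases i)
      case 0
      then show ?thesis using matched_flip[OF True] by simp
    next
      case (Suc j)
      then show ?thesis using a(2)[of j] that v(2) by (simp add: funpow_swap1)
    qed
    then show ?thesis using a(1) v by (intro exI[of _ "Suc a"]) (simp add: funpow_swap1)
  next
    case False
    then show ?thesis using a by (intro exI[of _ a]) simp
  qed
qed

text \<open>On a maximal chain of the matching, the unmatched last element is sent back to the first.\<close>

lemma bij_close_matching: "bij (close_matching q p N)"
proof -
  let ?f = "close_matching q p N"
  have inj_unmatched: "u = v"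
    if "\<not> matched q p N u" "\<not> matched q p N v" and
      eq: "(step_back q p N ^^ N) u = (step_back q p N ^^ N) v" for u v
  proof -
    define e where "e = (step_back q p N ^^ N) u"
    obtain a where a: "(q ^^ a) e = u" "\<And>i. i < a \<Longrightarrow> matched q p N ((q ^^ i) e)"
      using step_back_undo[of q N p N u] unfolding e_def by blast
    obtain b where b: "(q ^^ b) e = v" "\<And>i. i < b \<Longrightarrow> matched q p N ((q ^^ i) e)"
      using step_back_undo[of q N p N v] eq unfolding e_def by auto
    \<comment> \<open>Both are the number of steps after which the forward walk from
      \<open>e\<close> first leaves the matching.\<close>
    have "a = b" using a b that(1,2) by (metis linorder_neqE_nat)
    then show ?thesis using a b by simp
  qed
  have "inj ?f"
  proof (rule injI)
    fix u v assume eq: "?f u = ?f v"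
    show "u = v"
    proof (cases "matched q p N u"; cases "matched q p N v")
      assume "matched q p N u" "matched q p N v"
      then show ?thesis using eq by (metis close_matching_def matched_def)
    next
      assume *: "matched q p N u" "\<not> matched q p N v"
      then show ?thesis
        using eq matched_flip[OF *(1)] step_back_end_unmatched[OF *(2)] by (simp add: close_matching_def)
    next
      assume *: "\<not> matched q p N u" "matched q p N v"
      then show ?thesis
        using eq matched_flip[OF *(2)] step_back_end_unmatched[OF *(1)] by (simp add: close_matching_def)
    next
      assume "\<not> matched q p N u" "\<not> matched q p N v"
      then show ?thesis using eq inj_unmatched by (simp add: close_matching_def)
    qed
  qed
  moreover have "\<exists>u. ?f u = v" for v
  proof (cases "v < N")
    case True
    \<comment> \<open>Below \<open>N\<close> surjectivity follows from injectivity on a finite set;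
      from \<open>N\<close> on the map is the identity.\<close>
    have "(step_back q p N ^^ i) u < N" if "u < N" for u i
    proof (induction i)
      case (Suc i)
      then show ?case
        by (cases "matched p q N ((step_back q p N ^^ i) u)") (auto simp: matched_def)
    qed (use that in simp)
    then have "?f ` {..<N} \<subseteq> {..<N}"
      by (auto simp: close_matching_def matched_def)
    then have "?f ` {..<N} = {..<N}"
      by (intro endo_inj_surj finite_lessThan inj_on_subset[OF \<open>inj ?f\<close>] subset_UNIV)
    then have "v \<in> ?f ` {..<N}" using True by (simp only: lessThan_iff)
    then show ?thesis by (elim imageE) (rule exI, erule sym)
  next
    case False
    then have "\<not> matched q p N v" "\<not> matched p q N v" by (simp_all add: matched_def)
    then have "?f v = v" using step_back_fixed[of p q N 0 v N] by (simp add: close_matching_def)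
    then show ?thesis by (rule exI)
  qed
  ultimately show ?thesis unfolding bij_def surj_def by metis
qed

section \<open>The upper bound\<close>

text \<open>This is \<open>close_matching\<close> for the functions with programs \<open>Q\<close>
  and \<open>P\<close> under the evaluator \<open>f\<close>. All calls precede the branching, so
  only total conditionals occur; for total programs every call converges.\<close>

definition run_close :: "(nat \<rightharpoonup> nat) \<Rightarrow> nat \<Rightarrow> nat \<Rightarrow> nat \<Rightarrow> nat \<rightharpoonup> nat" where
  "run_close f Q P N z =
    Option.bind (f (prod_encode (Q, z))) (\<lambda>u. Option.bind (f (prod_encode (P, u))) (\<lambda>u'.
    Option.bind (rec_nat (Some z) (\<lambda>_ r. Option.bind r (\<lambda>v.
        Option.bind (f (prod_encode (P, v))) (\<lambda>w. Option.bind (f (prod_encode (Q, w))) (\<lambda>w'.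
          Some (if v < N \<and> w < N \<and> w' = v then w else v))))) N)
      (\<lambda>e. Some (if z < N \<and> u < N \<and> u' = z then u else e))))"

lemma partial_rec_run_close:
  assumes f: "partial_recursive f" and "total_rec a" "total_rec b" "total_rec c" "total_rec d"
  shows "partial_recursive (\<lambda>n. run_close f (a n) (b n) (c n) (d n))"
  unfolding run_close_def
  by (intro partial_rec_bind partial_rec_rec_nat partial_rec_comp_total[OF f] partial_rec_total
      rec_intros assms(2-) assms(2-)[THEN total_rec_comp])

lemma run_close_eq:
  assumes "\<And>v. f (prod_encode (Q, v)) = Some (q v)" "\<And>v. f (prod_encode (P, v)) = Some (p v)"
  shows "run_close f Q P N z = Some (close_matching q p N z)"
proof -
  have "rec_nat (Some z) (\<lambda>_ r. Option.bind r (\<lambda>v.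
        Option.bind (f (prod_encode (P, v))) (\<lambda>w. Option.bind (f (prod_encode (Q, w))) (\<lambda>w'.
          Some (if v < N \<and> w < N \<and> w' = v then w else v))))) k = Some ((step_back q p N ^^ k) z)" for k
    by (induction k) (auto simp: assms step_back_def[of q p N "(step_back q p N ^^ _) z"] matched_def)
  then show ?thesis
    by (simp add: run_close_def assms close_matching_def matched_def)
qed

text \<open>A string can serve as a program for the constant function with itself as value, and the
  Goedel property translates it into a total program of \<open>U\<close>. Hence the complexities in
  the upper bound are finite and the length field is short.\<close>

lemma total_cond_complexity_le_length:
  assumes "optimal_language U" "goedel_language U"
  shows "\<exists>c. \<forall>x y. total_cond_complexity U x y \<le> enat (length x + c)"
proof -
  let ?V = "\<lambda>p y. map_option str_decode (Some (pfst (prod_encode (str_code p, str_code y))))"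
  have "programming_language ?V"
    by (rule programming_language_of[of "\<lambda>e. Some (pfst e)"]) (rule partial_recursive.left)
  then obtain h where h: "computable h" "\<And>p y. U (h p) y = ?V p y"
    using assms(2) unfolding goedel_language_def by blast
  then obtain g where g: "partial_recursive g" "\<And>p. g (str_code p) = Some (str_code (h p))"
    unfolding computable_def by blast
  obtain c where "\<And>x p. g (str_code p) = Some (str_code x) \<Longrightarrow> complexity U x \<le> enat (length p + c)"
    using optimal_complexity_le[OF assms(1) g(1)] by blast
  then have "complexity U (h x) \<le> enat (length x + c)" for x using g(2) by blast
  moreover have "total_program U (h x)" "U (h x) y = Some x" for x y
    by (simp_all add: total_program_def h(2))
  ultimately show ?thesis unfolding total_cond_complexity_def INF_le_enat_iff by blast
qed

lemma total_cond_complexity_witness: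
  assumes "total_cond_complexity U x y = enat a"
  obtains p d where "total_program U p" "U p y = Some x" "U d [] = Some p" "length d \<le> a"
proof -
  have "total_cond_complexity U x y \<le> enat a" using assms by simp
  then obtain p where "total_program U p" "U p y = Some x" "complexity U p \<le> enat a"
    unfolding total_cond_complexity_def INF_le_enat_iff by blast
  then show ?thesis using that unfolding complexity_def cond_complexity_le_iff by blast
qed

lemma ex_power_two_gt:
  assumes "n \<ge> 1" shows "\<exists>J. n < 2 ^ J \<and> real J \<le> 1 + log 2 (real n)"
proof -
  define J where "J = nat \<lfloor>log 2 (real n)\<rfloor> + 1"
  have pos: "log 2 (real n) \<ge> 0" using assms by simp
  have J: "real J = of_int \<lfloor>log 2 (real n)\<rfloor> + 1" using pos by (simp add: J_def)
  then have "log 2 (real n) < real J" by linarith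
  then have "real n < 2 powr real J" using assms by (simp add: log_less_iff)
  then have "real n < real (2 ^ J)" by (simp add: powr_realpow)
  then show ?thesis using J by (intro exI[of _ J]) linarith
qed

text \<open>Beyond the joined descriptions of \<open>p\<close> and \<open>q\<close>, only
  \<open>n\<close> and the splitting position must be recorded, and both have logarithmic
  length.\<close>

lemma permutation_upper_bound:
  assumes "optimal_language U" "goedel_language U"
  shows "\<exists>c::real. \<forall>n\<ge>2. \<forall>x y :: bool list. length x \<le> n \<and> length y \<le> n \<longrightarrow>
            (\<exists>t. computes_permutation U t \<and> U t x = Some y \<and>
              ereal_of_enat (complexity U t)
                \<le> ereal_of_enat (total_cond_complexity U x y)
                  + ereal_of_enat (total_cond_complexity U y x) + ereal (c * log 2 (real n)))"
proof -
  obtain f where f: "partial_recursive f"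
    "\<And>p y. f (prod_encode (str_code p, str_code y)) = map_option str_code (U p y)"
    using assms(2) unfolding goedel_language_def programming_language_def by blast
  \<comment> \<open>The input is \<open>((l, (n, r)), z)\<close>: the low \<open>l\<close> bits of
    \<open>r\<close> describe \<open>P\<close>, the others \<open>Q\<close>. The descriptions are
    run on the empty string, whose code is 0.\<close>
  define F where "F e = Option.bind (f (prod_encode (psnd (psnd (pfst e)) mod 2 ^ pfst (pfst e), 0)))
    (\<lambda>P. Option.bind (f (prod_encode (psnd (psnd (pfst e)) div 2 ^ pfst (pfst e), 0)))
      (\<lambda>Q. run_close f Q P (2 ^ Suc (pfst (psnd (pfst e)))) (psnd e)))" for e
  have "partial_recursive F" unfolding F_def
    by (intro partial_rec_bind partial_rec_run_close partial_rec_comp_total[OF f(1)] f(1)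
        total_rec_div total_rec_mod rec_intros)
  from programming_language_of[OF this] obtain h where h: "computable h"
    "\<And>w y. U (h w) y = map_option str_decode (F (prod_encode (str_code w, str_code y)))"
    using assms(2) unfolding goedel_language_def by blast
  then obtain g where g: "partial_recursive g" "\<And>p. g (str_code p) = Some (str_code (h p))"
    unfolding computable_def by blast
  obtain c where c: "\<And>l n r b J x. g (prod_encode (l, prod_encode (n, r))) = Some (str_code x) \<Longrightarrow>
    l < 2 ^ J \<Longrightarrow> n < 2 ^ J \<Longrightarrow> r < 2 ^ b \<Longrightarrow> complexity U x \<le> enat (b + 3 * J + c)"
    using complexity_triple_le[OF assms(1) g(1)] by blast
  obtain c0 where c0: "\<And>x y. total_cond_complexity U x y \<le> enat (length x + c0)"
    using total_cond_complexity_le_length[OF assms] by blast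
  \<comment> \<open>The overhead is at most \<open>8 + 3 * c0 + c + 3 * log 2 n\<close>, and
    \<open>1 \<le> log 2 n\<close> absorbs the constant part into the coefficient.\<close>
  define K where "K = 11 + 3 * real c0 + real c"
  have "\<exists>t. computes_permutation U t \<and> U t x = Some y \<and>
      ereal_of_enat (complexity U t) \<le> ereal_of_enat (total_cond_complexity U x y)
        + ereal_of_enat (total_cond_complexity U y x) + ereal (K * log 2 (real n))"
    if n: "n \<ge> 2" and x: "length x \<le> n" and y: "length y \<le> n" for n x y
  proof -
    obtain A where A: "total_cond_complexity U x y = enat A" "A \<le> n + c0"
      using c0[of x y] x by (cases "total_cond_complexity U x y") auto
    obtain B where B: "total_cond_complexity U y x = enat B"
      using c0[of y x] by (cases "total_cond_complexity U y x") auto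
    obtain p d where p: "total_program U p" "U p y = Some x" "U d [] = Some p" "length d \<le> A"
      using total_cond_complexity_witness[OF A(1)] .
    obtain q d' where q: "total_program U q" "U q x = Some y" "U d' [] = Some q" "length d' \<le> B"
      using total_cond_complexity_witness[OF B] .
    define \<pi> where "\<pi> v = str_code (the (U p (str_decode v)))" for v
    define \<kappa> where "\<kappa> v = str_code (the (U q (str_decode v)))" for v
    have \<pi>: "f (prod_encode (str_code p, v)) = Some (\<pi> v)" for v
    proof -
      obtain w where "U p (str_decode v) = Some w" using p(1) unfolding total_program_def by blast
      then show ?thesis using f(2)[of p "str_decode v"] by (simp add: \<pi>_def)
    qed
    have \<kappa>: "f (prod_encode (str_code q, v)) = Some (\<kappa> v)" for v
    proof -
      obtain w where "U q (str_decode v) = Some w" using q(1) unfolding total_program_def by blast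
      then show ?thesis using f(2)[of q "str_decode v"] by (simp add: \<kappa>_def)
    qed
    define N :: nat where "N = 2 ^ Suc n"
    have code_less: "str_code s < 2 ^ Suc m" if "length s \<le> m" for s m
    proof -
      have "(2::nat) ^ Suc (length s) \<le> 2 ^ Suc m" using that by (intro power_increasing) auto
      then show ?thesis using str_code_bounds(2)[of s] by linarith
    qed
    \<comment> \<open>Codes of strings of length at most \<open>A\<close> are below
      \<open>2 ^ Suc A\<close>, so remainder and quotient recover both descriptions.\<close>
    define r where "r = str_code d + 2 ^ Suc A * str_code d'"
    have "r < 2 ^ Suc A * 2 ^ Suc B" unfolding r_def
      using p(4) q(4) by (intro mixed_radix_less code_less)
    then have r: "r < 2 ^ (A + B + 2)" by (simp add: power_add)
    have r_split: "r mod 2 ^ Suc A = str_code d" "r div 2 ^ Suc A = str_code d'"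
      using code_less[OF p(4)] unfolding r_def by (simp_all del: power_Suc)
    define e where "e = prod_encode (Suc A, prod_encode (n, r))"
    define t where "t = h (str_decode e)"
    have f0: "f (prod_encode (str_code s, 0)) = map_option str_code (U s [])" for s
      using f(2)[of s "[]"] by simp
    have F: "F (prod_encode (e, z)) = Some (close_matching \<kappa> \<pi> N z)" for z
      using run_close_eq[of f "str_code q" \<kappa> "str_code p" \<pi>, OF \<kappa> \<pi>]
      by (simp add: F_def e_def r_split f0 p(3) q(3) N_def del: power_Suc)
    have t: "U t z = Some (str_decode (close_matching \<kappa> \<pi> N (str_code z)))" for z
      by (simp add: t_def h(2) F)
    have "bij (str_decode \<circ> close_matching \<kappa> \<pi> N \<circ> str_code)"
      by (intro bij_comp bij_close_matching bij_str_code bij_imp_bij_inv)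
    then have "computes_permutation U t" unfolding computes_permutation_def using t by force
    moreover have "U t x = Some y"
    proof -
      have "matched \<kappa> \<pi> N (str_code x)" "\<kappa> (str_code x) = str_code y"
        using code_less[OF x] code_less[OF y] p(2) q(2)
        by (simp_all add: matched_def \<kappa>_def \<pi>_def N_def)
      then show ?thesis by (simp add: t close_matching_def)
    qed
    moreover have "ereal_of_enat (complexity U t) \<le> ereal_of_enat (total_cond_complexity U x y)
        + ereal_of_enat (total_cond_complexity U y x) + ereal (K * log 2 (real n))"
    proof -
      obtain J where J: "n < 2 ^ J" "real J \<le> 1 + log 2 (real n)"
        using ex_power_two_gt[of n] n by auto
      \<comment> \<open>\<open>A\<close> may exceed \<open>n\<close> by up to \<open>c0\<close>; the
        \<open>Suc c0\<close> extra bits make room for this.\<close>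
      have 1: "n < 2 ^ (J + Suc c0)" "Suc A < 2 ^ (J + Suc c0)"
      proof -
        have "Suc (Suc c0) \<le> 2 ^ Suc c0" using less_exp[of "Suc c0"] by simp
        with J(1) have "Suc n * Suc (Suc c0) \<le> 2 ^ J * 2 ^ Suc c0" by (intro mult_le_mono) auto
        then have "n + c0 + 2 \<le> 2 ^ (J + Suc c0)" unfolding power_add by simp
        then show "n < 2 ^ (J + Suc c0)" "Suc A < 2 ^ (J + Suc c0)" using A(2) by linarith+
      qed
      have "complexity U t \<le> enat (A + B + 2 + 3 * (J + Suc c0) + c)"
        by (rule c[OF _ 1(2,1) r]) (use g(2)[of "str_decode e"] in \<open>simp add: t_def e_def\<close>)
      then have "ereal_of_enat (complexity U t) \<le> ereal (real (A + B + 2 + 3 * (J + Suc c0) + c))"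
        by (metis ereal_of_enat_le_iff ereal_of_enat_simps(1))
      also have "real (A + B + 2 + 3 * (J + Suc c0) + c) \<le> real A + real B + K * log 2 (real n)"
      proof -
        have log: "1 \<le> log 2 (real n)" using n by (simp add: le_log_iff)
        have "0 \<le> (8 + 3 * real c0 + real c) * (log 2 (real n) - 1)" using log by simp
        then have "8 + 3 * real c0 + real c + 3 * log 2 (real n) \<le> K * log 2 (real n)"
          unfolding K_def by (simp add: algebra_simps)
        then show ?thesis using J(2) by simp
      qed
      finally show ?thesis by (simp add: A(1) B)
    qed
    ultimately show ?thesis by blast
  qed
  then show ?thesis by blast
qed

section \<open>The lower bound\<close>

lemma stages_opt_code_mono:
  assumes "stages g f" "opt_code (g s n) \<noteq> 0" "s \<le> t"
  shows "opt_code (g t n) = opt_code (g s n)"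
proof (cases "g s n")
  case (Some v)
  from stages_mono[OF assms(1) this assms(3)] Some show ?thesis by simp
qed (use assms(2) in simp)

text \<open>\<open>out g s p n i\<close> is the successor of the code of what the program described by \<open>p\<close> outputs on
  the \<open>i\<close>-th string of length \<open>n\<close>, and 0 as long as nothing has been output by stage \<open>s\<close>.
  A hit is an output among the first \<open>2 ^ k\<close> strings of length \<open>n\<close>.\<close>

definition out :: "(nat \<Rightarrow> nat \<rightharpoonup> nat) \<Rightarrow> nat \<Rightarrow> nat \<Rightarrow> nat \<Rightarrow> nat \<Rightarrow> nat" where
  "out g s p n i = opt_code (g s (prod_encode (opt_code (g s (prod_encode (p, 0))) - 1, 2 ^ n - 1 + i)))"

definition hit :: "(nat \<Rightarrow> nat \<rightharpoonup> nat) \<Rightarrow> nat \<Rightarrow> nat \<Rightarrow> nat \<Rightarrow> nat \<Rightarrow> nat \<Rightarrow> bool" where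
  "hit g s p k n i \<longleftrightarrow> 2 ^ n \<le> out g s p n i \<and> out g s p n i < 2 ^ n + 2 ^ k"

text \<open>The first conjunct guards against the default program code 0 in \<open>out\<close> while
  the description has produced nothing. The limit on hits feeds the averaging argument and holds for
  every permutation.\<close>

definition active :: "(nat \<Rightarrow> nat \<rightharpoonup> nat) \<Rightarrow> nat \<Rightarrow> nat \<Rightarrow> nat \<Rightarrow> nat \<Rightarrow> bool" where
  "active g s p k n \<longleftrightarrow> opt_code (g s (prod_encode (p, 0))) \<noteq> 0 \<and>
     (\<forall>i<2 ^ n. out g s p n i \<noteq> 0) \<and> (\<Sum>i<2 ^ n. of_bool (hit g s p k n i) :: nat) \<le> 2 ^ k"

section \<open>Decidability and persistence of activity\<close>

lemma total_rec_out:
  assumes g: "stages g f" and "total_rec a" "total_rec b" "total_rec c" "total_rec d"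
  shows "total_rec (\<lambda>e. out g (a e) (b e) (c e) (d e))"
  unfolding out_def by (intro rec_intros stages_rec[OF g] assms(2-))

lemma decidable_hit:
  assumes g: "stages g f" and "total_rec a" "total_rec b" "total_rec c" "total_rec d" "total_rec e"
  shows "decidable (\<lambda>x. hit g (a x) (b x) (c x) (d x) (e x))"
  unfolding hit_def by (intro rec_intros total_rec_out[OF g] assms(2-))

lemma decidable_active:
  assumes g: "stages g f" and "total_rec a" "total_rec b" "total_rec c" "total_rec d"
  shows "decidable (\<lambda>x. active g (a x) (b x) (c x) (d x))"
  unfolding active_def
  by (intro rec_intros stages_rec[OF g] total_rec_out[OF g] decidable_hit[OF g]
      assms(2-) assms(2-)[THEN total_rec_comp])

text \<open>For an active description the program and all its outputs on length \<open>n\<close> are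
  already known, and known values never change.\<close>

lemma out_stable:
  assumes g: "stages g f" and "active g s p k n" "s \<le> t" "i < 2 ^ n"
  shows "out g t p n i = out g s p n i"
proof -
  have "opt_code (g t (prod_encode (p, 0))) = opt_code (g s (prod_encode (p, 0)))"
    using assms by (intro stages_opt_code_mono[OF g]) (auto simp: active_def)
  moreover have "out g s p n i \<noteq> 0" using assms by (simp add: active_def)
  ultimately show ?thesis
    using stages_opt_code_mono[OF g _ assms(3)] unfolding out_def by simp
qed

lemma hit_stable:
  assumes "stages g f" "active g s p k n" "s \<le> t" "i < 2 ^ n"
  shows "hit g t p k n i \<longleftrightarrow> hit g s p k n i"
  using out_stable[OF assms] by (simp add: hit_def)

lemma active_mono:
  assumes g: "stages g f" and a: "active g s p k n" and "s \<le> t"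
  shows "active g t p k n"
proof -
  have "opt_code (g t (prod_encode (p, 0))) = opt_code (g s (prod_encode (p, 0)))"
    using assms by (intro stages_opt_code_mono[OF g]) (auto simp: active_def)
  moreover have "(\<Sum>i<2 ^ n. of_bool (hit g t p k n i) :: nat) = (\<Sum>i<2 ^ n. of_bool (hit g s p k n i))"
    using hit_stable[OF assms] by (intro sum.cong) auto
  ultimately show ?thesis using a out_stable[OF assms] by (simp add: active_def)
qed

text \<open>An injective function reaches each of the \<open>2 ^ k\<close> targets at most once, and
  the finitely many computations involved finish by a common stage.\<close>

lemma active_of_permutation:
  assumes g: "stages g f" and f0: "f (prod_encode (p, 0)) = Some t"
    and ft: "\<And>v. f (prod_encode (t, v)) = Some (\<phi> v)" and "inj \<phi>"
  shows "\<exists>s. active g s p k n \<and> (\<forall>i<2 ^ n. out g s p n i = Suc (\<phi> (2 ^ n - 1 + i)))"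
proof -
  have "\<forall>\<^sub>F s in sequentially. \<forall>i\<in>{..<2 ^ n}. g s (prod_encode (t, 2 ^ n - 1 + i)) = Some (\<phi> (2 ^ n - 1 + i))"
    by (intro eventually_ball_finite ballI stages_eventually[OF g] ft) simp
  with stages_eventually[OF g f0]
  have "\<forall>\<^sub>F s in sequentially. g s (prod_encode (p, 0)) = Some t \<and>
      (\<forall>i\<in>{..<2 ^ n}. g s (prod_encode (t, 2 ^ n - 1 + i)) = Some (\<phi> (2 ^ n - 1 + i)))"
    by eventually_elim blast
  then obtain s where s: "g s (prod_encode (p, 0)) = Some t"
    "\<And>i. i < 2 ^ n \<Longrightarrow> g s (prod_encode (t, 2 ^ n - 1 + i)) = Some (\<phi> (2 ^ n - 1 + i))"
    using eventually_happens'[OF sequentially_bot] by blast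
  then have out: "out g s p n i = Suc (\<phi> (2 ^ n - 1 + i))" if "i < 2 ^ n" for i
    using that by (simp add: out_def)
  have "inj_on (\<lambda>i. out g s p n i) ({..<2 ^ n} \<inter> {i. hit g s p k n i})"
  proof (rule inj_onI)
    fix i j
    assume "i \<in> {..<2 ^ n} \<inter> {i. hit g s p k n i}" "j \<in> {..<2 ^ n} \<inter> {i. hit g s p k n i}"
      and "out g s p n i = out g s p n j"
    then have "\<phi> (2 ^ n - 1 + i) = \<phi> (2 ^ n - 1 + j)" using out[of i] out[of j] by simp
    from injD[OF \<open>inj \<phi>\<close> this] show "i = j" by (simp only: add_left_cancel)
  qed
  moreover have "(\<lambda>i. out g s p n i) ` ({..<2 ^ n} \<inter> {i. hit g s p k n i}) \<subseteq> {2 ^ n..<2 ^ n + 2 ^ k}"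
    by (auto simp: hit_def)
  ultimately have "card ({..<2 ^ n} \<inter> {i. hit g s p k n i}) \<le> card {2 ^ n..<2 ^ n + 2 ^ k :: nat}"
    by (intro card_inj_on_le) auto
  then have "active g s p k n" using s out by (simp add: active_def)
  then show ?thesis using out by blast
qed

text \<open>Double counting of the pairs with \<open>H p i\<close>: there are at most
  \<open>4 ^ k * 2 ^ k\<close>, too few for more than \<open>2 ^ k / 2\<close> at every
  index.\<close>

lemma exists_rarely_hit:
  fixes H :: "nat \<Rightarrow> nat \<Rightarrow> bool"
  assumes "finite T" "card T \<le> 4 ^ k" "n > 2 * k"
    and H: "\<And>p. p \<in> T \<Longrightarrow> card ({..<2 ^ n} \<inter> {i. H p i}) \<le> 2 ^ k"
  shows "\<exists>i<2 ^ n. 2 * card (T \<inter> {p. H p i}) \<le> 2 ^ k"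
proof (rule ccontr)
  assume "\<not> ?thesis"
  then have *: "2 ^ k + 1 \<le> 2 * card (T \<inter> {p. H p i})" if "i < 2 ^ n" for i
    using that by force
  \<comment> \<open>The factor 2 is available because \<open>n > 2 * k\<close> gives
    \<open>2 ^ n \<ge> 2 * 4 ^ k\<close>.\<close>
  have "2 * (4 ^ k * (2 ^ k + 1)) = 2 ^ Suc (2 * k) * (2 ^ k + 1 :: nat)"
    by (simp add: power_mult)
  also have "\<dots> \<le> 2 ^ n * (2 ^ k + 1)"
    using assms(3) by (intro mult_right_mono power_increasing) auto
  also have "\<dots> = (\<Sum>i<(2::nat) ^ n. 2 ^ k + 1)" by simp
  also have "\<dots> \<le> (\<Sum>i<2 ^ n. 2 * card (T \<inter> {p. H p i}))"
    using * by (intro sum_mono) auto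
  also have "\<dots> = 2 * (\<Sum>i<2 ^ n. \<Sum>p\<in>T. of_bool (H p i))"
    using assms(1) by (simp add: sum_distrib_left)
  also have "\<dots> = 2 * (\<Sum>p\<in>T. \<Sum>i<2 ^ n. of_bool (H p i))"
    by (subst sum.swap) simp
  also have "\<dots> = 2 * (\<Sum>p\<in>T. card ({..<2 ^ n} \<inter> {i. H p i}))" by simp
  also have "\<dots> \<le> 2 * (\<Sum>p\<in>T. 2 ^ k)"
    using H by (intro mult_left_mono sum_mono) auto
  also have "\<dots> \<le> 2 * (4 ^ k * 2 ^ k)"
    using assms(2) by simp
  finally show False by simp
qed

text \<open>Covering the \<open>2 ^ k\<close> values takes as many members of \<open>T'\<close>, but
  \<open>T\<close> supplies at most half of that number and the rest of \<open>T'\<close> less than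
  half.\<close>

lemma exists_missed_value:
  fixes v :: "nat \<Rightarrow> nat"
  assumes "finite T'" "T \<subseteq> T'"
    and "2 * card (T \<inter> {p. b \<le> v p \<and> v p < b + 2 ^ k}) \<le> 2 ^ k" "2 * card T' < 2 * card T + 2 ^ k"
  shows "\<exists>j<2 ^ k. \<forall>p\<in>T'. v p \<noteq> b + j"
proof (rule ccontr)
  assume contra: "\<not> ?thesis"
  have "{b..<b + 2 ^ k} \<subseteq> v ` (T' \<inter> {p. b \<le> v p \<and> v p < b + 2 ^ k})"
  proof
    fix w assume w: "w \<in> {b..<b + 2 ^ k}"
    then have "w - b < 2 ^ k" "b + (w - b) = w" by auto
    with contra obtain p where "p \<in> T'" "v p = w" by metis
    with w show "w \<in> v ` (T' \<inter> {p. b \<le> v p \<and> v p < b + 2 ^ k})" by (intro image_eqI[of _ _ p]) auto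
  qed
  then have "card {b..<b + 2 ^ k} \<le> card (T' \<inter> {p. b \<le> v p \<and> v p < b + 2 ^ k})"
    using assms(1) by (intro surj_card_le) auto
  also have "\<dots> \<le> card ((T \<inter> {p. b \<le> v p \<and> v p < b + 2 ^ k}) \<union> (T' - T))"
    using assms(1,2) finite_subset[OF assms(2,1)] by (intro card_mono) auto
  also have "\<dots> \<le> card (T \<inter> {p. b \<le> v p \<and> v p < b + 2 ^ k}) + card (T' - T)"
    by (rule card_Un_le)
  also have "card (T' - T) = card T' - card T"
    by (intro card_Diff_subset assms(2) finite_subset[OF assms(2,1)])
  finally have "2 ^ k \<le> card (T \<inter> {p. b \<le> v p \<and> v p < b + 2 ^ k}) + (card T' - card T)" by simp
  then show False using assms(3,4) card_mono[OF assms(1,2)] by linarith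
qed

lemma permutation_lower_bound:
  assumes "optimal_language U"
  shows "\<exists>c1 c2 :: real. \<forall>k n :: nat. n > 2 * k \<longrightarrow>
            (\<exists>x y :: bool list. length x = n \<and> length y = n \<and>
              ereal_of_enat (complexity U x) \<le> ereal (real k + c1 * log 2 (real (max n 2))) \<and>
              ereal_of_enat (complexity U y) \<le> ereal (real k + c1 * log 2 (real (max n 2))) \<and>
              (\<forall>t. computes_permutation U t \<and> U t x = Some y \<longrightarrow>
                 ereal (2 * real k - c2) \<le> ereal_of_enat (complexity U t)))"
proof -
  obtain f where f: "partial_recursive f"
    "\<And>p y. f (prod_encode (str_code p, str_code y)) = map_option str_code (U p y)"
    using assms unfolding optimal_language_def programming_language_def by blast
  obtain g where g: "stages g f" using partial_recursive_stages[OF f(1)] by blast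
  \<comment> \<open>Descriptions of length below \<open>2 * k\<close> have codes below
    \<open>4 ^ k\<close>, so the sums cover all of them.\<close>
  define count where "count s k n = (\<Sum>p<4 ^ k. of_bool (active g s p k n) :: nat)" for s k n
  define hits where "hits s k n i = (\<Sum>p<4 ^ k. of_bool (active g s p k n \<and> hit g s p k n i) :: nat)" for s k n i
  \<comment> \<open>On input \<open>(k, (n, j))\<close>, wait for at least
    \<open>j * 2 ^ k / 2\<close> active descriptions, then take the first string that is rarely hit
    at that stage.\<close>
  define X where "X e = Option.bind
      (least_opt (\<lambda>s. psnd (psnd e) * 2 ^ pfst e \<le> 2 * count s (pfst e) (pfst (psnd e))))
      (\<lambda>s. Option.bind
        (least_opt (\<lambda>i. i < 2 ^ pfst (psnd e) \<and> 2 * hits s (pfst e) (pfst (psnd e)) i \<le> 2 ^ pfst e))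
        (\<lambda>i. Some (2 ^ pfst (psnd e) - 1 + i)))" for e
  define Y where "Y e = 2 ^ pfst (psnd e) - 1 + psnd (psnd e)" for e
  have X_rec: "partial_recursive X" unfolding X_def count_def hits_def
    by (intro partial_rec_bind partial_rec_least_opt partial_rec_total rec_intros
        decidable_active[OF g] decidable_hit[OF g])
  have Y_rec: "partial_recursive (\<lambda>e. Some (Y e))" unfolding Y_def
    by (intro partial_rec_total rec_intros)
  obtain cx where cx: "\<And>l n r b J x. X (prod_encode (l, prod_encode (n, r))) = Some (str_code x) \<Longrightarrow>
    l < 2 ^ J \<Longrightarrow> n < 2 ^ J \<Longrightarrow> r < 2 ^ b \<Longrightarrow> complexity U x \<le> enat (b + 3 * J + cx)"
    using complexity_triple_le[OF assms X_rec] by blast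
  obtain cy where cy: "\<And>l n r b J x. Some (Y (prod_encode (l, prod_encode (n, r)))) = Some (str_code x) \<Longrightarrow>
    l < 2 ^ J \<Longrightarrow> n < 2 ^ J \<Longrightarrow> r < 2 ^ b \<Longrightarrow> complexity U x \<le> enat (b + 3 * J + cy)"
    using complexity_triple_le[OF assms Y_rec] by blast
  \<comment> \<open>The overhead \<open>2 + 3 * J\<close> is at most 5 plus three logarithms; as the
    logarithm is at least 1, the constants move into the coefficient.\<close>
  define c1 where "c1 = 8 + real cx + real cy"
  \<comment> \<open>The witness for \<open>c2\<close> is 0.\<close>
  have "\<exists>x y :: bool list. length x = n \<and> length y = n \<and>
      ereal_of_enat (complexity U x) \<le> ereal (real k + c1 * log 2 (real (max n 2))) \<and>
      ereal_of_enat (complexity U y) \<le> ereal (real k + c1 * log 2 (real (max n 2))) \<and>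
      (\<forall>t. computes_permutation U t \<and> U t x = Some y \<longrightarrow>
         ereal (2 * real k - 0) \<le> ereal_of_enat (complexity U t))"
    if kn: "n > 2 * k" for k n
  proof -
    define T where "T s = {..<4 ^ k} \<inter> {p. active g s p k n}" for s
    have finT: "finite (T s)" for s by (simp add: T_def)
    have T_mono: "T s \<subseteq> T s'" if "s \<le> s'" for s s'
      using active_mono[OF g _ that] by (auto simp: T_def)
    have count: "count s k n = card (T s)" for s by (simp add: count_def T_def)
    have hits: "hits s k n i = card (T s \<inter> {p. hit g s p k n i})" for s i
      by (simp add: hits_def T_def Int_assoc Collect_conj_eq)
    have card_T: "card (T s) \<le> 4 ^ k" for s
      using card_mono[of "{..<4 ^ k}" "T s"] by (auto simp: T_def)
    define M where "M = {p. p < 4 ^ k \<and> (\<exists>s. active g s p k n)}"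
    \<comment> \<open>Only finitely many descriptions are considered, so all that ever become active
      are active at some stage \<open>S\<close>.\<close>
    have "\<forall>\<^sub>F s in sequentially. \<forall>p\<in>M. active g s p k n"
    proof (intro eventually_ball_finite ballI)
      show "\<forall>\<^sub>F s in sequentially. active g s p k n" if "p \<in> M" for p
        using that active_mono[OF g] unfolding M_def eventually_sequentially by blast
    qed (simp add: M_def)
    then obtain S where "\<forall>p\<in>M. active g S p k n"
      using eventually_happens'[OF sequentially_bot] by blast
    then have S: "p \<in> T S" if "p < 4 ^ k" "active g s p k n" for p s
      using that unfolding M_def T_def by blast
    \<comment> \<open>The final number of active descriptions in units of \<open>2 ^ k / 2\<close>,
      rounded down. It is at most \<open>2 ^ (k + 1)\<close>, hence fits into \<open>k + 2\<close>
      bits.\<close>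
    define j where "j = 2 * card (T S) div 2 ^ k"
    have j: "j * 2 ^ k \<le> 2 * card (T S)" "2 * card (T S) < j * 2 ^ k + 2 ^ k"
    proof -
      show "j * 2 ^ k \<le> 2 * card (T S)" unfolding j_def by (rule div_times_less_eq_dividend)
      have "2 * card (T S) mod 2 ^ k < 2 ^ k" by simp
      then show "2 * card (T S) < j * 2 ^ k + 2 ^ k"
        unfolding j_def using div_mult_mod_eq[of "2 * card (T S)" "2 ^ k"] by linarith
    qed
    have j_less: "j < 2 ^ (k + 2)"
    proof -
      have "j \<le> 2 * 4 ^ k div 2 ^ k" unfolding j_def using card_T by (intro div_le_mono) simp
      also have "(4::nat) ^ k = 2 ^ k * 2 ^ k" by (simp flip: power_mult_distrib)
      finally have "j \<le> 2 * 2 ^ k" by simp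
      also have "\<dots> < 2 ^ (k + 2)" by simp
      finally show ?thesis .
    qed
    \<comment> \<open>This stage is determined by \<open>k\<close>, \<open>n\<close> and
      \<open>j\<close>; fewer than \<open>2 ^ k / 2\<close> descriptions become active after
      it.\<close>
    define s where "s = (LEAST s. j * 2 ^ k \<le> 2 * count s k n)"
    have s: "j * 2 ^ k \<le> 2 * card (T s)" "s \<le> S"
      using LeastI[of "\<lambda>s. j * 2 ^ k \<le> 2 * count s k n" S]
        Least_le[of "\<lambda>s. j * 2 ^ k \<le> 2 * count s k n" S] j(1) by (simp_all add: s_def count)
    define i where "i = (LEAST i. i < 2 ^ n \<and> 2 * hits s k n i \<le> 2 ^ k)"
    have ex_i: "\<exists>i. i < 2 ^ n \<and> 2 * hits s k n i \<le> 2 ^ k"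
    proof -
      have "card ({..<2 ^ n} \<inter> {i. hit g s p k n i}) \<le> 2 ^ k" if "p \<in> T s" for p
        using that by (simp add: T_def active_def)
      from exists_rarely_hit[OF finT card_T kn this] show ?thesis by (simp add: hits)
    qed
    then have i: "i < 2 ^ n" "2 * hits s k n i \<le> 2 ^ k"
      unfolding i_def by (metis (mono_tags, lifting) LeastI)+
    have X: "X (prod_encode (k, prod_encode (n, j))) = Some (2 ^ n - 1 + i)"
    proof -
      have "least_opt (\<lambda>s. j * 2 ^ k \<le> 2 * count s k n) = Some s"
        using j(1) unfolding least_opt_def s_def count by auto
      moreover have "least_opt (\<lambda>i. i < 2 ^ n \<and> 2 * hits s k n i \<le> 2 ^ k) = Some i"
        using ex_i unfolding least_opt_def i_def by simp
      ultimately show ?thesis by (simp add: X_def)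
    qed
    \<comment> \<open>\<open>X\<close> counts hits at stage \<open>s\<close>; stability expresses
      them by outputs at stage \<open>S\<close>, so one output function serves both
      \<open>T s\<close> and \<open>T S\<close>.\<close>
    have "T s \<inter> {p. hit g s p k n i} = T s \<inter> {p. 2 ^ n \<le> out g S p n i \<and> out g S p n i < 2 ^ n + 2 ^ k}"
      using hit_stable[OF g _ s(2) i(1)] unfolding T_def hit_def by blast
    then have "\<exists>j'<2 ^ k. \<forall>p\<in>T S. out g S p n i \<noteq> 2 ^ n + j'"
      using i(2) s(1) j(2) by (intro exists_missed_value[OF finT T_mono[OF s(2)]]) (simp_all add: hits)
    then obtain j' where j': "j' < 2 ^ k" "\<And>p. p \<in> T S \<Longrightarrow> out g S p n i \<noteq> 2 ^ n + j'" by blast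
    define x where "x = str_decode (2 ^ n - 1 + i)"
    define y where "y = str_decode (2 ^ n - 1 + j')"
    have pow: "(1::nat) \<le> 2 ^ n" "(2::nat) ^ k \<le> 2 ^ n" using kn by (auto intro: power_increasing)
    have len: "length x = n" "length y = n"
      using i(1) less_le_trans[OF j'(1) pow(2)] by (auto simp: x_def y_def length_eq_iff_str_code)
    obtain J where J: "max n 2 < 2 ^ J" "real J \<le> 1 + log 2 (real (max n 2))"
      using ex_power_two_gt[of "max n 2"] by (metis max.cobounded2 one_le_numeral order_trans)
    have J': "k < 2 ^ J" "n < 2 ^ J" using J(1) kn by auto
    have log: "1 \<le> log 2 (real (max n 2))" by (simp add: le_log_iff)
    have le: "ereal_of_enat z \<le> ereal (real k + c1 * log 2 (real (max n 2)))"
      if "z \<le> enat (k + 2 + 3 * J + cx + cy)" for z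
    proof -
      have "ereal_of_enat z \<le> ereal (real (k + 2 + 3 * J + cx + cy))"
        using that by (metis ereal_of_enat_le_iff ereal_of_enat_simps(1))
      also have "real (k + 2 + 3 * J + cx + cy) \<le> real k + c1 * log 2 (real (max n 2))"
      proof -
        have "0 \<le> (5 + real cx + real cy) * (log 2 (real (max n 2)) - 1)" using log by simp
        then have "5 + real cx + real cy + 3 * log 2 (real (max n 2)) \<le> c1 * log 2 (real (max n 2))"
          unfolding c1_def by (simp add: algebra_simps)
        then show ?thesis using J(2) by simp
      qed
      finally show ?thesis by simp
    qed
    have "complexity U x \<le> enat (k + 2 + 3 * J + cx)"
      by (rule cx[OF _ J' j_less]) (simp add: X x_def)
    then have "complexity U x \<le> enat (k + 2 + 3 * J + cx + cy)"
      by (rule order_trans) simp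
    moreover have "complexity U y \<le> enat (k + 3 * J + cy)"
      by (rule cy[OF _ J' j'(1)]) (simp add: Y_def y_def)
    then have "complexity U y \<le> enat (k + 2 + 3 * J + cx + cy)"
      by (rule order_trans) simp
    moreover have "ereal (2 * real k - 0) \<le> ereal_of_enat (complexity U t)"
      if t: "computes_permutation U t" "U t x = Some y" for t
    proof (rule ccontr)
      assume "\<not> ?thesis"
      then have "ereal_of_enat (complexity U t) < ereal (real (2 * k))" by simp
      then have "complexity U t < enat (2 * k)"
        by (metis ereal_of_enat_less_iff ereal_of_enat_simps(1))
      then obtain d where d: "U d [] = Some t" "length d < 2 * k"
        unfolding complexity_def cond_complexity_def INF_less_iff by auto
      have "(2::nat) ^ Suc (length d) \<le> 2 ^ (2 * k)" using d(2) by (intro power_increasing) auto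
      then have d_less: "str_code d < 4 ^ k" using str_code_bounds(2)[of d] by (simp add: power_mult)
      obtain \<phi> where \<phi>: "bij \<phi>" "\<And>z. U t z = Some (\<phi> z)"
        using t(1) unfolding computes_permutation_def by blast
      define \<psi> where "\<psi> = str_code \<circ> \<phi> \<circ> str_decode"
      have "inj \<psi>" unfolding \<psi>_def
        by (intro bij_is_inj bij_comp \<phi>(1) bij_str_code bij_imp_bij_inv)
      moreover have "f (prod_encode (str_code d, 0)) = Some (str_code t)"
        using f(2)[of d "[]"] d(1) by simp
      moreover have "f (prod_encode (str_code t, v)) = Some (\<psi> v)" for v
        using f(2)[of t "str_decode v"] \<phi>(2) by (simp add: \<psi>_def)
      ultimately obtain s' where s': "active g s' (str_code d) k n"
        "\<And>i. i < 2 ^ n \<Longrightarrow> out g s' (str_code d) n i = Suc (\<psi> (2 ^ n - 1 + i))"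
        using active_of_permutation[OF g] by metis
      have d_T: "str_code d \<in> T S" using S[OF d_less s'(1)] .
      \<comment> \<open>\<open>s'\<close> may lie before or after \<open>S\<close>, so both outputs
        are compared at the later stage.\<close>
      have "out g S (str_code d) n i = out g (max s' S) (str_code d) n i"
        using out_stable[OF g _ _ i(1), of S "str_code d" k "max s' S"] d_T by (simp add: T_def)
      also have "\<dots> = out g s' (str_code d) n i"
        by (rule out_stable[OF g s'(1) _ i(1)]) simp
      also have "\<dots> = Suc (\<psi> (2 ^ n - 1 + i))" using s'(2) i(1) .
      also have "\<psi> (2 ^ n - 1 + i) = 2 ^ n - 1 + j'"
        using \<phi>(2)[of x] t(2) by (simp add: \<psi>_def x_def y_def)
      \<comment> \<open>The successor built into \<open>out\<close> cancels the \<open>- 1\<close>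
        in the code of \<open>y\<close>.\<close>
      finally have "out g S (str_code d) n i = 2 ^ n + j'" using pow(1) by simp
      with j'(2)[OF d_T] show False by simp
    qed
    ultimately show ?thesis using len le by blast
  qed
  then show ?thesis by blast
qed

theorem theorem3:
  fixes U :: language
  assumes "optimal_language U" and "goedel_language U"
  shows "(\<exists>c::real. \<forall>n\<ge>2. \<forall>x y :: bool list. length x \<le> n \<and> length y \<le> n \<longrightarrow>
            (\<exists>t. computes_permutation U t \<and> U t x = Some y \<and>
              ereal_of_enat (complexity U t)
                \<le> ereal_of_enat (total_cond_complexity U x y)
                  + ereal_of_enat (total_cond_complexity U y x) + ereal (c * log 2 (real n))))
       \<and> (\<exists>c1 c2 :: real. \<forall>k n :: nat. n > 2 * k \<longrightarrow>
            (\<exists>x y :: bool list. length x = n \<and> length y = n \<and>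
              ereal_of_enat (complexity U x) \<le> ereal (real k + c1 * log 2 (real (max n 2))) \<and>
              ereal_of_enat (complexity U y) \<le> ereal (real k + c1 * log 2 (real (max n 2))) \<and>
              (\<forall>t. computes_permutation U t \<and> U t x = Some y \<longrightarrow>
                 ereal (2 * real k - c2) \<le> ereal_of_enat (complexity U t))))"
  using permutation_upper_bound[OF assms] permutation_lower_bound[OF assms(1)] by (rule conjI)

end
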